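(* Let $T$ be a recursively enumerable theory in the language of arithmetic extending Robinson's arithmetic $Q$ whose provability predicate $\mathrm{Pr}_T$ satisfies the Hilbert–Bernays–Löb derivability conditions. Then $T$ is sound if and only if every Gödelian sentence of $T$ is true in $\mathbb{N}$.
   Context: $\mathbb{N}$ is the standard model of arithmetic; $T$ is sound iff every $T$-provable sentence is true in $\mathbb{N}$. For a formula $\sigma$, $\#\sigma$ denotes the canonical numeral for the Gödel number of $\sigma$, and $\mathrm{Pr}_T(x)$ is an arithmetized provability predicate for $T$ with $\mathbb{N}\vDash\mathrm{Pr}_T(\#\sigma)$ iff $T\vdash\sigma$. A sentence $G$ is a Gödelian sentence of $T$ iff $T\vdash G\leftrightarrow\neg\mathrm{Pr}_T(\#G)$. The derivability conditions: (D1) if $T\vdash\sigma$ then $T\vdash\mathrm{Pr}_T(\#\sigma)$; (D2) $T\vdash\mathrm{Pr}_T(\#(\sigma\to\rho))\to(\mathrm{Pr}_T(\#\sigma)\to\mathrm{Pr}_T(\#\rho))$; (D3) $T\vdash\mathrm{Pr}_T(\#\sigma)\to\mathrm{Pr}_T(\#\mathrm{Pr}_T(\#\sigma))$. *)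

theory Defs
  imports Main "HOL-Library.Nat_Bijection"
begin

section \<open>The language of arithmetic\<close>

text \<open>Variables are de Bruijn indices: in \<open>Forall \<phi>\<close> the index 0 of \<open>\<phi>\<close> is the bound variable
  and index \<open>Suc n\<close> of \<open>\<phi>\<close> refers to index \<open>n\<close> outside.\<close>

datatype tm = Var nat | Zero | Succ tm | Plus tm tm | Times tm tm

datatype fm = Eq tm tm | Falsum | Imp fm fm | Forall fm

abbreviation Neg :: "fm \<Rightarrow> fm" where
  "Neg \<phi> \<equiv> Imp \<phi> Falsum"

abbreviation Conj :: "fm \<Rightarrow> fm \<Rightarrow> fm" where
  "Conj \<phi> \<psi> \<equiv> Neg (Imp \<phi> (Neg \<psi>))"

abbreviation Disj :: "fm \<Rightarrow> fm \<Rightarrow> fm" where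
  "Disj \<phi> \<psi> \<equiv> Imp (Neg \<phi>) \<psi>"

abbreviation Iff :: "fm \<Rightarrow> fm \<Rightarrow> fm" where
  "Iff \<phi> \<psi> \<equiv> Conj (Imp \<phi> \<psi>) (Imp \<psi> \<phi>)"

abbreviation Exists :: "fm \<Rightarrow> fm" where
  "Exists \<phi> \<equiv> Neg (Forall (Neg \<phi>))"

primrec fv_tm :: "tm \<Rightarrow> nat set" where
  "fv_tm (Var n) = {n}"
| "fv_tm Zero = {}"
| "fv_tm (Succ t) = fv_tm t"
| "fv_tm (Plus s t) = fv_tm s \<union> fv_tm t"
| "fv_tm (Times s t) = fv_tm s \<union> fv_tm t"

primrec fv :: "fm \<Rightarrow> nat set" where
  "fv (Eq s t) = fv_tm s \<union> fv_tm t"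
| "fv Falsum = {}"
| "fv (Imp \<phi> \<psi>) = fv \<phi> \<union> fv \<psi>"
| "fv (Forall \<phi>) = {n. Suc n \<in> fv \<phi>}"

definition sentence :: "fm \<Rightarrow> bool" where
  "sentence \<phi> \<longleftrightarrow> fv \<phi> = {}"

primrec subst_tm :: "(nat \<Rightarrow> tm) \<Rightarrow> tm \<Rightarrow> tm" where
  "subst_tm \<theta> (Var n) = \<theta> n"
| "subst_tm \<theta> Zero = Zero"
| "subst_tm \<theta> (Succ t) = Succ (subst_tm \<theta> t)"
| "subst_tm \<theta> (Plus s t) = Plus (subst_tm \<theta> s) (subst_tm \<theta> t)"
| "subst_tm \<theta> (Times s t) = Times (subst_tm \<theta> s) (subst_tm \<theta> t)"

abbreviation lift_tm :: "tm \<Rightarrow> tm" where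
  "lift_tm \<equiv> subst_tm (\<lambda>n. Var (Suc n))"

primrec subst :: "(nat \<Rightarrow> tm) \<Rightarrow> fm \<Rightarrow> fm" where
  "subst \<theta> (Eq s t) = Eq (subst_tm \<theta> s) (subst_tm \<theta> t)"
| "subst \<theta> Falsum = Falsum"
| "subst \<theta> (Imp \<phi> \<psi>) = Imp (subst \<theta> \<phi>) (subst \<theta> \<psi>)"
| "subst \<theta> (Forall \<phi>) = Forall (subst (case_nat (Var 0) (\<lambda>n. lift_tm (\<theta> n))) \<phi>)"

definition lift :: "fm \<Rightarrow> fm" where
  "lift \<phi> = subst (\<lambda>n. Var (Suc n)) \<phi>"

text \<open>\<open>inst \<phi> t\<close> is \<open>\<phi>(t)\<close>: index 0 is replaced by \<open>t\<close>, all other indices drop by one.\<close>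

definition inst :: "fm \<Rightarrow> tm \<Rightarrow> fm" where
  "inst \<phi> t = subst (case_nat t Var) \<phi>"


section \<open>Truth in the standard model\<close>

primrec val :: "(nat \<Rightarrow> nat) \<Rightarrow> tm \<Rightarrow> nat" where
  "val e (Var n) = e n"
| "val e Zero = 0"
| "val e (Succ t) = Suc (val e t)"
| "val e (Plus s t) = val e s + val e t"
| "val e (Times s t) = val e s * val e t"

primrec sat :: "(nat \<Rightarrow> nat) \<Rightarrow> fm \<Rightarrow> bool" where
  "sat e (Eq s t) \<longleftrightarrow> val e s = val e t"
| "sat e Falsum \<longleftrightarrow> False"
| "sat e (Imp \<phi> \<psi>) \<longleftrightarrow> (sat e \<phi> \<longrightarrow> sat e \<psi>)"
| "sat e (Forall \<phi>) \<longleftrightarrow> (\<forall>x. sat (case_nat x e) \<phi>)"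

definition true_in_N :: "fm \<Rightarrow> bool" where
  "true_in_N \<phi> \<longleftrightarrow> (\<forall>e. sat e \<phi>)"


section \<open>Provability in classical first-order logic with equality\<close>

inductive provable :: "fm set \<Rightarrow> fm \<Rightarrow> bool" (infix \<open>\<turnstile>\<close> 50) where
  Assm: "\<phi> \<in> T \<Longrightarrow> T \<turnstile> \<phi>"
| ImpI: "insert \<phi> T \<turnstile> \<psi> \<Longrightarrow> T \<turnstile> Imp \<phi> \<psi>"
| ImpE: "T \<turnstile> Imp \<phi> \<psi> \<Longrightarrow> T \<turnstile> \<phi> \<Longrightarrow> T \<turnstile> \<psi>"
| Contr: "insert (Neg \<phi>) T \<turnstile> Falsum \<Longrightarrow> T \<turnstile> \<phi>"
| ForallI: "lift ` T \<turnstile> \<phi> \<Longrightarrow> T \<turnstile> Forall \<phi>"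
| ForallE: "T \<turnstile> Forall \<phi> \<Longrightarrow> T \<turnstile> inst \<phi> t"
| EqRefl: "T \<turnstile> Eq t t"
| EqSubst: "T \<turnstile> Eq s t \<Longrightarrow> T \<turnstile> inst \<phi> s \<Longrightarrow> T \<turnstile> inst \<phi> t"


section \<open>Recursively enumerable sets\<close>

datatype recf = Zr | Sc | Proj nat | Comp recf "recf list" | PrimRec recf recf | Mu recf

text \<open>\<open>computes f xs y\<close>: the partial recursive function denoted by \<open>f\<close> is defined
  at the arguments \<open>xs\<close> and has value \<open>y\<close> there.\<close>

inductive computes :: "recf \<Rightarrow> nat list \<Rightarrow> nat \<Rightarrow> bool" where
  "computes Zr xs 0"
| "computes Sc [x] (Suc x)"
| "i < length xs \<Longrightarrow> computes (Proj i) xs (xs ! i)"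
| "list_all2 (\<lambda>g y. computes g xs y) gs ys \<Longrightarrow> computes f ys z \<Longrightarrow> computes (Comp f gs) xs z"
| "computes f xs y \<Longrightarrow> computes (PrimRec f g) (0 # xs) y"
| "computes (PrimRec f g) (n # xs) r \<Longrightarrow> computes g (n # r # xs) y \<Longrightarrow>
     computes (PrimRec f g) (Suc n # xs) y"
| "computes f (n # xs) 0 \<Longrightarrow> \<forall>m<n. \<exists>k. computes f (m # xs) (Suc k) \<Longrightarrow> computes (Mu f) xs n"

definition re_set :: "nat set \<Rightarrow> bool" where
  "re_set A \<longleftrightarrow> (\<exists>f. \<forall>n. n \<in> A \<longleftrightarrow> (\<exists>y. computes f [n] y))"


section \<open>Goedel numbers and numerals\<close>

primrec gn_tm :: "tm \<Rightarrow> nat" where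
  "gn_tm (Var n) = prod_encode (0, n)"
| "gn_tm Zero = prod_encode (1, 0)"
| "gn_tm (Succ t) = prod_encode (2, gn_tm t)"
| "gn_tm (Plus s t) = prod_encode (3, prod_encode (gn_tm s, gn_tm t))"
| "gn_tm (Times s t) = prod_encode (4, prod_encode (gn_tm s, gn_tm t))"

primrec gn :: "fm \<Rightarrow> nat" where
  "gn (Eq s t) = prod_encode (0, prod_encode (gn_tm s, gn_tm t))"
| "gn Falsum = prod_encode (1, 0)"
| "gn (Imp \<phi> \<psi>) = prod_encode (2, prod_encode (gn \<phi>, gn \<psi>))"
| "gn (Forall \<phi>) = prod_encode (3, gn \<phi>)"

primrec numeral_tm :: "nat \<Rightarrow> tm" where
  "numeral_tm 0 = Zero"
| "numeral_tm (Suc n) = Succ (numeral_tm n)"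

definition quote_fm :: "fm \<Rightarrow> tm" where
  "quote_fm \<phi> = numeral_tm (gn \<phi>)"


section \<open>Arithmetical theories\<close>

text \<open>A theory is given by a set of axioms, which need not be deductively closed.\<close>

definition arith_theory :: "fm set \<Rightarrow> bool" where
  "arith_theory T \<longleftrightarrow> (\<forall>\<phi>\<in>T. sentence \<phi>)"

definition re_theory :: "fm set \<Rightarrow> bool" where
  "re_theory T \<longleftrightarrow> re_set (gn ` T)"

definition robinson_Q :: "fm set" where
  "robinson_Q =
    {Forall (Neg (Eq (Succ (Var 0)) Zero)),
     Forall (Forall (Imp (Eq (Succ (Var 0)) (Succ (Var 1))) (Eq (Var 0) (Var 1)))),
     Forall (Disj (Eq (Var 0) Zero) (Exists (Eq (Var 1) (Succ (Var 0))))),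
     Forall (Eq (Plus (Var 0) Zero) (Var 0)),
     Forall (Forall (Eq (Plus (Var 0) (Succ (Var 1))) (Succ (Plus (Var 0) (Var 1))))),
     Forall (Eq (Times (Var 0) Zero) Zero),
     Forall (Forall (Eq (Times (Var 0) (Succ (Var 1))) (Plus (Times (Var 0) (Var 1)) (Var 0))))}"

definition extends_Q :: "fm set \<Rightarrow> bool" where
  "extends_Q T \<longleftrightarrow> (\<forall>\<phi>\<in>robinson_Q. T \<turnstile> \<phi>)"

definition sound :: "fm set \<Rightarrow> bool" where
  "sound T \<longleftrightarrow> (\<forall>\<sigma>. sentence \<sigma> \<longrightarrow> T \<turnstile> \<sigma> \<longrightarrow> true_in_N \<sigma>)"


section \<open>Provability predicates\<close>

text \<open>The free variable of a provability predicate is the index 0.\<close>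

definition provability_predicate :: "fm set \<Rightarrow> fm \<Rightarrow> bool" where
  "provability_predicate T Pr \<longleftrightarrow> fv Pr \<subseteq> {0} \<and>
     (\<forall>\<sigma>. sentence \<sigma> \<longrightarrow> (true_in_N (inst Pr (quote_fm \<sigma>)) \<longleftrightarrow> T \<turnstile> \<sigma>))"

definition derivability_conditions :: "fm set \<Rightarrow> fm \<Rightarrow> bool" where
  "derivability_conditions T Pr \<longleftrightarrow>
     (\<forall>\<sigma>. sentence \<sigma> \<longrightarrow> T \<turnstile> \<sigma> \<longrightarrow> T \<turnstile> inst Pr (quote_fm \<sigma>)) \<and>
     (\<forall>\<sigma> \<rho>. sentence \<sigma> \<longrightarrow> sentence \<rho> \<longrightarrow>
        T \<turnstile> Imp (inst Pr (quote_fm (Imp \<sigma> \<rho>)))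
                (Imp (inst Pr (quote_fm \<sigma>)) (inst Pr (quote_fm \<rho>)))) \<and>
     (\<forall>\<sigma>. sentence \<sigma> \<longrightarrow>
        T \<turnstile> Imp (inst Pr (quote_fm \<sigma>)) (inst Pr (quote_fm (inst Pr (quote_fm \<sigma>)))))"

definition goedelian :: "fm set \<Rightarrow> fm \<Rightarrow> fm \<Rightarrow> bool" where
  "goedelian T Pr G \<longleftrightarrow> sentence G \<and> T \<turnstile> Iff G (Neg (inst Pr (quote_fm G)))"

end

theory Submission imports Defs "HOL-Number_Theory.Cong" begin

text \<open>If \<open>T\<close> is sound and \<open>G\<close> is Goedelian, then \<open>G\<close> is true iff \<open>T\<close> does not prove \<open>G\<close>, and a provable
  \<open>G\<close> would be true, so \<open>G\<close> is true. Conversely, let \<open>T\<close> prove \<open>\<sigma>\<close>. The diagonal lemma yields a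
  Goedelian sentence \<open>G\<close>. Since \<open>T\<close> proves \<open>G \<leftrightarrow> G \<and> \<sigma>\<close>, the first two derivability conditions make
  \<open>Pr(#G)\<close> and \<open>Pr(#(G \<and> \<sigma>))\<close> provably equivalent, so \<open>G \<and> \<sigma>\<close> is Goedelian too; being true, it
  makes \<open>\<sigma>\<close> true.\<close>

section \<open>Substitution\<close>

text \<open>The weight lies on the diagonal lemma. \<open>T\<close> is only known to contain
  \<open>Q\<close>, which has no induction, so general facts about order, pairing or sequences
  cannot be expected inside \<open>T\<close>. The coding is therefore confined to bounded formulas:
  at numerals \<open>T\<close> proves them when true and refutes them when false, so the coding can
  be verified by evaluating truth in the standard model. The induction that \<open>Q\<close> lacks
  is carried out outside, on the numerals. Existence and uniqueness of the value of the diagonal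
  function are what remains to be proved inside \<open>T\<close>.\<close>

abbreviation up :: "(nat \<Rightarrow> tm) \<Rightarrow> nat \<Rightarrow> tm" where
  "up \<theta> \<equiv> case_nat (Var 0) (\<lambda>n. lift_tm (\<theta> n))"

lemma subst_tm_cong: "(\<And>n. n \<in> fv_tm t \<Longrightarrow> \<theta> n = \<eta> n) \<Longrightarrow> subst_tm \<theta> t = subst_tm \<eta> t"
  by (induction t) auto

lemma subst_cong: "(\<And>n. n \<in> fv \<phi> \<Longrightarrow> \<theta> n = \<eta> n) \<Longrightarrow> subst \<theta> \<phi> = subst \<eta> \<phi>"
proof (induction \<phi> arbitrary: \<theta> \<eta>)
  case (Eq s t)
  have "subst_tm \<theta> s = subst_tm \<eta> s" "subst_tm \<theta> t = subst_tm \<eta> t"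
    by (rule subst_tm_cong, rule Eq.prems, simp)+
  then show ?case by simp
next
  case (Forall \<phi>)
  have "up \<theta> n = up \<eta> n" if "n \<in> fv \<phi>" for n
    using that Forall.prems by (cases n) simp_all
  then have "subst (up \<theta>) \<phi> = subst (up \<eta>) \<phi>"
    by (rule Forall.IH)
  then show ?case by simp
next
  case (Imp \<phi> \<psi>)
  have "subst \<theta> \<phi> = subst \<eta> \<phi>" "subst \<theta> \<psi> = subst \<eta> \<psi>"
    by (rule Imp.IH, rule Imp.prems, simp)+
  then show ?case by simp
qed simp

lemma subst_tm_Var [simp]: "subst_tm Var t = t"
  by (induction t) auto

lemma up_Var: "case_nat (Var 0) (\<lambda>n. Var (Suc n)) = Var"
  by (auto split: nat.split)

lemma subst_Var [simp]: "subst Var \<phi> = \<phi>"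
  by (induction \<phi>) (simp_all add: up_Var)

lemma subst_tm_comp: "subst_tm \<eta> (subst_tm \<theta> t) = subst_tm (\<lambda>n. subst_tm \<eta> (\<theta> n)) t"
  by (induction t) auto

lemma up_comp: "(\<lambda>n. subst_tm (up \<eta>) (up \<theta> n)) = up (\<lambda>n. subst_tm \<eta> (\<theta> n))"
  by (auto split: nat.split simp: subst_tm_comp)

lemma subst_comp: "subst \<eta> (subst \<theta> \<phi>) = subst (\<lambda>n. subst_tm \<eta> (\<theta> n)) \<phi>"
proof (induction \<phi> arbitrary: \<theta> \<eta>)
  case (Forall \<phi>)
  show ?case unfolding subst.simps Forall up_comp ..
qed (simp_all add: subst_tm_comp)

text \<open>The variable that \<open>up\<close> protects is the one that \<open>inst\<close> fills,
  and the lifting cancels. Successive instantiations merge into one parallel substitution, the form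
  in which nested quantifiers are handled below.\<close>

lemma inst_subst_up: "inst (subst (up \<theta>) \<phi>) t = subst (case_nat t \<theta>) \<phi>"
  unfolding inst_def subst_comp
  by (rule subst_cong) (auto split: nat.split simp: subst_tm_comp)

lemma subst_inst: "subst \<theta> (inst \<phi> t) = inst (subst (up \<theta>) \<phi>) (subst_tm \<theta> t)"
  unfolding inst_subst_up unfolding inst_def subst_comp
  by (rule subst_cong) (auto split: nat.split)

lemma subst_lift: "subst (up \<theta>) (lift \<phi>) = lift (subst \<theta> \<phi>)"
  unfolding lift_def subst_comp by simp

lemma subst_case_lift_tm [simp]: "subst_tm (case_nat t \<theta>) (lift_tm s) = subst_tm \<theta> s"
  unfolding subst_tm_comp by simp

lemma subst_sentence: "sentence \<phi> \<Longrightarrow> subst \<theta> \<phi> = \<phi>"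
  using subst_cong[of \<phi> \<theta> Var] by (simp add: sentence_def)

lemma lift_sentence: "sentence \<phi> \<Longrightarrow> lift \<phi> = \<phi>"
  unfolding lift_def by (rule subst_sentence)

lemma lift_Imp [simp]: "lift (Imp \<phi> \<psi>) = Imp (lift \<phi>) (lift \<psi>)"
  and lift_Eq [simp]: "lift (Eq s t) = Eq (lift_tm s) (lift_tm t)"
  and lift_Falsum [simp]: "lift Falsum = Falsum"
  by (simp_all add: lift_def)

section \<open>Free variables and truth under substitution\<close>

lemma fv_subst_tm: "fv_tm (subst_tm \<theta> t) = (\<Union>n\<in>fv_tm t. fv_tm (\<theta> n))"
  by (induction t) auto

lemma fv_lift_tm [simp]: "fv_tm (lift_tm t) = Suc ` fv_tm t"
  by (auto simp: fv_subst_tm)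

lemma Suc_in_fv_up: "Suc n \<in> fv_tm (up \<theta> m) \<longleftrightarrow> (\<exists>k. m = Suc k \<and> n \<in> fv_tm (\<theta> k))"
  by (cases m) auto

lemma fv_subst: "fv (subst \<theta> \<phi>) = (\<Union>n\<in>fv \<phi>. fv_tm (\<theta> n))"
proof (induction \<phi> arbitrary: \<theta>)
  case (Forall \<phi>)
  show ?case unfolding subst.simps fv.simps Forall UN_iff Suc_in_fv_up by auto
qed (simp_all add: fv_subst_tm)

lemma fv_numeral [simp]: "fv_tm (numeral_tm n) = {}"
  by (induction n) auto

lemma subst_numeral [simp]: "subst_tm \<theta> (numeral_tm n) = numeral_tm n"
  by (induction n) auto

lemma val_numeral [simp]: "val e (numeral_tm n) = n"
  by (induction n) auto

lemma sentence_inst_numeral: "fv \<phi> \<subseteq> {0} \<Longrightarrow> sentence (inst \<phi> (numeral_tm n))"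
  unfolding sentence_def inst_def by (auto simp: fv_subst)

lemma val_subst: "val e (subst_tm \<theta> t) = val (\<lambda>n. val e (\<theta> n)) t"
  by (induction t) auto

lemma sat_subst: "sat e (subst \<theta> \<phi>) = sat (\<lambda>n. val e (\<theta> n)) \<phi>"
proof (induction \<phi> arbitrary: \<theta> e)
  case (Forall \<phi>)
  have "(\<lambda>n. val (case_nat x e) (up \<theta> n)) = case_nat x (\<lambda>n. val e (\<theta> n))" for x
    by (auto simp: val_subst split: nat.split)
  then show ?case by (simp add: Forall)
qed (auto simp: val_subst)

lemma val_lift [simp]: "val (case_nat x e) (lift_tm t) = val e t"
  by (simp add: val_subst)

text \<open>Substituting the numerals of \<open>e'\<close> leaves a sentence unchanged, while by
  \<open>sat_subst\<close> it turns the environment \<open>e\<close> into \<open>e'\<close>.\<close>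

lemma sat_sentence:
  assumes "sentence \<phi>" shows "sat e \<phi> = true_in_N \<phi>"
proof -
  have "sat e \<phi> = sat e' \<phi>" for e e'
  proof -
    have "sat e \<phi> = sat e (subst (\<lambda>n. numeral_tm (e' n)) \<phi>)"
      by (simp add: subst_sentence assms)
    then show ?thesis by (simp add: sat_subst)
  qed
  then show ?thesis unfolding true_in_N_def by blast
qed


section \<open>Derived rules\<close>

lemma weaken: "T \<turnstile> \<phi> \<Longrightarrow> T \<subseteq> \<Gamma> \<Longrightarrow> \<Gamma> \<turnstile> \<phi>"
proof (induction arbitrary: \<Gamma> rule: provable.induct)
  case (ImpI \<phi> T \<psi>)
  then show ?case by (meson insert_mono provable.ImpI)
next
  case (Contr \<phi> T)
  then show ?case by (meson insert_mono provable.Contr)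
next
  case (ForallI T \<phi>)
  then show ?case by (meson image_mono provable.ForallI)
next
  case (EqSubst T s t \<phi>)
  then show ?case using provable.EqSubst[of \<Gamma> s t \<phi>] by blast
qed (auto intro: Assm ImpE ForallE EqRefl)

lemma weaken_insert: "\<Gamma> \<turnstile> \<phi> \<Longrightarrow> insert \<psi> \<Gamma> \<turnstile> \<phi>"
  by (erule weaken) auto

lemma Imp_iff: "\<Gamma> \<turnstile> Imp \<phi> \<psi> \<longleftrightarrow> insert \<phi> \<Gamma> \<turnstile> \<psi>"
  by (meson Assm ImpE ImpI insertI1 weaken_insert)

lemma cut: "\<Gamma> \<turnstile> \<phi> \<Longrightarrow> insert \<phi> \<Gamma> \<turnstile> \<psi> \<Longrightarrow> \<Gamma> \<turnstile> \<psi>"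
  using ImpE ImpI by blast

text \<open>Meant for \<open>provable_lift\<close>; the induction needs arbitrary substitutions
  because \<open>ForallI\<close> turns \<open>\<theta>\<close> into
  \<open>up \<theta>\<close>.\<close>

lemma provable_subst: "T \<turnstile> \<phi> \<Longrightarrow> subst \<theta> ` T \<turnstile> subst \<theta> \<phi>"
proof (induction arbitrary: \<theta> rule: provable.induct)
  case (ForallI T \<phi>)
  have "subst (up \<theta>) ` lift ` T = lift ` subst \<theta> ` T"
    by (simp add: image_image subst_lift)
  with ForallI.IH[of "up \<theta>"] show ?case by (simp add: provable.ForallI)
next
  case (ForallE T \<phi> t)
  then show ?case by (simp add: subst_inst provable.ForallE)
next
  case (EqSubst T s t \<phi>)
  then show ?case
    using provable.EqSubst[of "subst \<theta> ` T" "subst_tm \<theta> s" "subst_tm \<theta> t" "subst (up \<theta>) \<phi>"]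
    by (simp add: subst_inst)
next
  case (ImpI \<phi> T \<psi>)
  then show ?case by (simp add: provable.ImpI)
next
  case (Contr \<phi> T)
  then show ?case by (simp add: provable.Contr)
next
  case (ImpE T \<phi> \<psi>)
  then show ?case by simp (metis provable.ImpE)
qed (auto intro: Assm EqRefl)

lemma provable_lift: "\<Gamma> \<turnstile> \<phi> \<Longrightarrow> lift ` \<Gamma> \<turnstile> lift \<phi>"
  unfolding lift_def by (rule provable_subst)

lemma Imp_trans: "\<Gamma> \<turnstile> Imp \<phi> \<psi> \<Longrightarrow> \<Gamma> \<turnstile> Imp \<psi> \<chi> \<Longrightarrow> \<Gamma> \<turnstile> Imp \<phi> \<chi>"
  unfolding Imp_iff by (rule cut, assumption, erule weaken) auto

lemma FalsumE: "\<Gamma> \<turnstile> Falsum \<Longrightarrow> \<Gamma> \<turnstile> \<phi>"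
  by (rule Contr) (rule weaken_insert)

lemma NegE: "\<Gamma> \<turnstile> Neg \<phi> \<Longrightarrow> \<Gamma> \<turnstile> \<phi> \<Longrightarrow> \<Gamma> \<turnstile> \<psi>"
  by (rule FalsumE) (rule ImpE)

text \<open>\<open>Conj\<close> and \<open>Iff\<close> unfold to negated implications, so this
  equivalence underlies their introduction and elimination; \<open>decides_Imp\<close> uses it to
  refute implications.\<close>

lemma Neg_Imp_iff: "\<Gamma> \<turnstile> Neg (Imp \<phi> \<psi>) \<longleftrightarrow> \<Gamma> \<turnstile> \<phi> \<and> \<Gamma> \<turnstile> Neg \<psi>"
proof (intro iffI conjI)
  assume *: "\<Gamma> \<turnstile> Neg (Imp \<phi> \<psi>)"
  have "insert (Neg \<phi>) \<Gamma> \<turnstile> Imp \<phi> \<psi>"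
    by (rule ImpI, rule NegE[of _ \<phi>]) (simp_all add: Assm)
  then show "\<Gamma> \<turnstile> \<phi>"
    by (rule Contr[OF ImpE[OF weaken_insert[OF *]]])
  have "insert \<psi> \<Gamma> \<turnstile> Imp \<phi> \<psi>"
    by (rule ImpI) (simp add: Assm)
  then show "\<Gamma> \<turnstile> Neg \<psi>"
    by (rule ImpI[OF ImpE[OF weaken_insert[OF *]]])
next
  assume *: "\<Gamma> \<turnstile> \<phi> \<and> \<Gamma> \<turnstile> Neg \<psi>"
  have "insert (Imp \<phi> \<psi>) \<Gamma> \<turnstile> \<psi>"
    by (rule ImpE[of _ \<phi>]) (simp_all add: Assm weaken_insert *)
  then show "\<Gamma> \<turnstile> Neg (Imp \<phi> \<psi>)"
    using * by - (rule ImpI, rule NegE[of _ \<psi>], simp_all add: weaken_insert)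
qed

lemma Neg_Neg_iff: "\<Gamma> \<turnstile> Neg (Neg \<phi>) \<longleftrightarrow> \<Gamma> \<turnstile> \<phi>"
proof
  assume "\<Gamma> \<turnstile> Neg (Neg \<phi>)"
  then show "\<Gamma> \<turnstile> \<phi>" by (rule Contr[OF iffD1[OF Imp_iff]])
next
  assume "\<Gamma> \<turnstile> \<phi>"
  then show "\<Gamma> \<turnstile> Neg (Neg \<phi>)"
    by - (rule ImpI, rule NegE[of _ \<phi>], simp_all add: Assm weaken_insert)
qed

lemma Conj_iff: "\<Gamma> \<turnstile> Conj \<phi> \<psi> \<longleftrightarrow> \<Gamma> \<turnstile> \<phi> \<and> \<Gamma> \<turnstile> \<psi>"
  unfolding Neg_Imp_iff[of _ \<phi>] Neg_Neg_iff ..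

lemma Iff_trans:
  assumes "\<Gamma> \<turnstile> Iff \<phi> \<psi>" "\<Gamma> \<turnstile> Iff \<psi> \<chi>" shows "\<Gamma> \<turnstile> Iff \<phi> \<chi>"
  using assms Imp_trans unfolding Conj_iff by blast

lemma case_split:
  assumes "insert \<phi> \<Gamma> \<turnstile> \<psi>" "insert (Neg \<phi>) \<Gamma> \<turnstile> \<psi>" shows "\<Gamma> \<turnstile> \<psi>"
proof (rule Contr)
  let ?\<Delta> = "insert (Neg \<psi>) \<Gamma>"
  have neg: "insert \<chi> ?\<Delta> \<turnstile> Falsum" if "insert \<chi> \<Gamma> \<turnstile> \<psi>" for \<chi>
  proof (rule NegE[of _ \<psi>])
    show "insert \<chi> ?\<Delta> \<turnstile> \<psi>" by (rule weaken[OF that]) auto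
  qed (simp add: Assm)
  have "?\<Delta> \<turnstile> Neg \<phi>" by (rule ImpI) (rule neg, fact)
  moreover have "?\<Delta> \<turnstile> Neg (Neg \<phi>)" by (rule ImpI) (rule neg, fact)
  ultimately show "?\<Delta> \<turnstile> Falsum" by (rule ImpE[rotated])
qed

lemma DisjE:
  assumes "\<Gamma> \<turnstile> Disj \<phi> \<psi>" "insert \<phi> \<Gamma> \<turnstile> \<chi>" "insert \<psi> \<Gamma> \<turnstile> \<chi>" shows "\<Gamma> \<turnstile> \<chi>"
proof (rule case_split)
  show "insert \<phi> \<Gamma> \<turnstile> \<chi>" by fact
  have "insert (Neg \<phi>) \<Gamma> \<turnstile> \<psi>" using assms(1) by (simp only: Imp_iff)
  then show "insert (Neg \<phi>) \<Gamma> \<turnstile> \<chi>"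
    by (rule cut) (rule weaken[OF assms(3)], auto)
qed

lemma DisjI1: "\<Gamma> \<turnstile> \<phi> \<Longrightarrow> \<Gamma> \<turnstile> Disj \<phi> \<psi>"
  by - (rule ImpI, rule NegE[of _ \<phi>], simp_all add: Assm weaken_insert)

lemma DisjI2: "\<Gamma> \<turnstile> \<psi> \<Longrightarrow> \<Gamma> \<turnstile> Disj \<phi> \<psi>"
  by (rule ImpI) (rule weaken_insert)

lemma ExI: "\<Gamma> \<turnstile> inst \<phi> t \<Longrightarrow> \<Gamma> \<turnstile> Exists \<phi>"
proof (rule ImpI)
  assume "\<Gamma> \<turnstile> inst \<phi> t"
  moreover have "insert (Forall (Neg \<phi>)) \<Gamma> \<turnstile> inst (Neg \<phi>) t"
    by (rule ForallE) (simp add: Assm)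
  ultimately show "insert (Forall (Neg \<phi>)) \<Gamma> \<turnstile> Falsum"
    by (simp add: inst_def) (rule ImpE, assumption, rule weaken_insert)
qed

text \<open>Index 0 is the eigenvariable; lifting \<open>\<Gamma>\<close> and \<open>\<psi>\<close>
  is what makes it fresh.\<close>

lemma ExE:
  assumes "\<Gamma> \<turnstile> Exists \<phi>" "insert \<phi> (lift ` \<Gamma>) \<turnstile> lift \<psi>" shows "\<Gamma> \<turnstile> \<psi>"
proof (rule Contr)
  let ?\<Delta> = "insert (Neg \<psi>) \<Gamma>"
  have "insert \<phi> (lift ` ?\<Delta>) \<turnstile> Falsum"
  proof (rule NegE)
    show "insert \<phi> (lift ` ?\<Delta>) \<turnstile> Neg (lift \<psi>)" by (simp add: Assm)
    show "insert \<phi> (lift ` ?\<Delta>) \<turnstile> lift \<psi>" by (rule weaken[OF assms(2)]) auto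
  qed
  then have "?\<Delta> \<turnstile> Forall (Neg \<phi>)" by (intro ForallI ImpI)
  then show "?\<Delta> \<turnstile> Falsum" by (rule ImpE[OF weaken_insert[OF assms(1)]])
qed

section \<open>Equality reasoning\<close>

text \<open>\<open>EqSubst\<close> rewrites index 0 only. So \<open>?\<phi>\<close> is
  \<open>\<phi>\<close> with variable \<open>n\<close> moved to index 0 and everything else lifted
  out of its way.\<close>

lemma subst_eq:
  assumes "\<Gamma> \<turnstile> Eq s t" "\<Gamma> \<turnstile> subst (\<theta>(n := s)) \<phi>" shows "\<Gamma> \<turnstile> subst (\<theta>(n := t)) \<phi>"
proof -
  let ?\<phi> = "subst (\<lambda>m. if m = n then Var 0 else lift_tm (\<theta> m)) \<phi>"
  have "inst ?\<phi> u = subst (\<theta>(n := u)) \<phi>" for u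
    unfolding inst_def subst_comp by (rule subst_cong) auto
  then show ?thesis using EqSubst[of \<Gamma> s t ?\<phi>] assms by simp
qed

lemma inst_Eq: "inst (Eq s t) u = Eq (subst_tm (case_nat u Var) s) (subst_tm (case_nat u Var) t)"
  by (simp add: inst_def)

text \<open>In the formula handed to \<open>EqSubst\<close>, index 0 marks the occurrence to be
  rewritten; here its instance at \<open>s\<close> is reflexivity. The congruences below follow the
  same pattern.\<close>

lemma eq_sym: "\<Gamma> \<turnstile> Eq s t \<Longrightarrow> \<Gamma> \<turnstile> Eq t s"
  using EqSubst[of \<Gamma> s t "Eq (Var 0) (lift_tm s)"] by (simp add: inst_Eq EqRefl)

lemma eq_trans: "\<Gamma> \<turnstile> Eq s t \<Longrightarrow> \<Gamma> \<turnstile> Eq t u \<Longrightarrow> \<Gamma> \<turnstile> Eq s u"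
  using EqSubst[of \<Gamma> t u "Eq (lift_tm s) (Var 0)"] by (simp add: inst_Eq)

lemma eq_Succ: "\<Gamma> \<turnstile> Eq s t \<Longrightarrow> \<Gamma> \<turnstile> Eq (Succ s) (Succ t)"
  using EqSubst[of \<Gamma> s t "Eq (lift_tm (Succ s)) (Succ (Var 0))"] by (simp add: inst_Eq EqRefl)

lemma eq_Plus:
  assumes "\<Gamma> \<turnstile> Eq s s'" "\<Gamma> \<turnstile> Eq t t'" shows "\<Gamma> \<turnstile> Eq (Plus s t) (Plus s' t')"
proof (rule eq_trans)
  show "\<Gamma> \<turnstile> Eq (Plus s t) (Plus s' t)"
    using EqSubst[of \<Gamma> s s' "Eq (lift_tm (Plus s t)) (Plus (Var 0) (lift_tm t))"] assms(1)
    by (simp add: inst_Eq EqRefl)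
  show "\<Gamma> \<turnstile> Eq (Plus s' t) (Plus s' t')"
    using EqSubst[of \<Gamma> t t' "Eq (lift_tm (Plus s' t)) (Plus (lift_tm s') (Var 0))"] assms(2)
    by (simp add: inst_Eq EqRefl)
qed

lemma eq_Times:
  assumes "\<Gamma> \<turnstile> Eq s s'" "\<Gamma> \<turnstile> Eq t t'" shows "\<Gamma> \<turnstile> Eq (Times s t) (Times s' t')"
proof (rule eq_trans)
  show "\<Gamma> \<turnstile> Eq (Times s t) (Times s' t)"
    using EqSubst[of \<Gamma> s s' "Eq (lift_tm (Times s t)) (Times (Var 0) (lift_tm t))"] assms(1)
    by (simp add: inst_Eq EqRefl)
  show "\<Gamma> \<turnstile> Eq (Times s' t) (Times s' t')"
    using EqSubst[of \<Gamma> t t' "Eq (lift_tm (Times s' t)) (Times (lift_tm s') (Var 0))"] assms(2)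
    by (simp add: inst_Eq EqRefl)
qed


section \<open>Arithmetic in Robinson's theory\<close>

text \<open>The witness is the left summand because \<open>Q\<close> recurses on the right one. With
  the summands exchanged, \<open>Le_Succ\<close> would call for laws about the left summand, which
  take induction.\<close>

definition Le :: "tm \<Rightarrow> tm \<Rightarrow> fm" where
  "Le s t = Exists (Eq (Plus (Var 0) (lift_tm s)) (lift_tm t))"

lemma subst_tm_lift_comp [simp]: "subst_tm (\<lambda>n. lift_tm (\<theta> n)) t = lift_tm (subst_tm \<theta> t)"
  by (simp add: subst_tm_comp)

lemma subst_Le [simp]: "subst \<theta> (Le s t) = Le (subst_tm \<theta> s) (subst_tm \<theta> t)"
  by (simp add: Le_def)

lemma lift_Le [simp]: "lift (Le s t) = Le (lift_tm s) (lift_tm t)"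
  by (simp add: lift_def)

lemma fv_Le [simp]: "fv (Le s t) = fv_tm s \<union> fv_tm t"
  by (auto simp: Le_def)

lemma sat_Le [simp]: "sat e (Le s t) \<longleftrightarrow> val e s \<le> val e t"
  by (auto simp: Le_def le_iff_add add.commute intro: sym)

lemma LeI: "\<Gamma> \<turnstile> Eq (Plus u s) t \<Longrightarrow> \<Gamma> \<turnstile> Le s t"
  unfolding Le_def by (rule ExI[where t = u]) (simp add: inst_Eq)

lemma LeE:
  assumes "\<Gamma> \<turnstile> Le s t"
    "insert (Eq (Plus (Var 0) (lift_tm s)) (lift_tm t)) (lift ` \<Gamma>) \<turnstile> lift \<phi>"
  shows "\<Gamma> \<turnstile> \<phi>"
  using assms unfolding Le_def by (rule ExE)

lemma Le_cong_left: "\<Gamma> \<turnstile> Eq s s' \<Longrightarrow> \<Gamma> \<turnstile> Le s t \<Longrightarrow> \<Gamma> \<turnstile> Le s' t"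
  using EqSubst[of \<Gamma> s s' "Le (Var 0) (lift_tm t)"] by (simp add: inst_def)

lemma Le_cong_right: "\<Gamma> \<turnstile> Eq t t' \<Longrightarrow> \<Gamma> \<turnstile> Le s t \<Longrightarrow> \<Gamma> \<turnstile> Le s t'"
  using EqSubst[of \<Gamma> t t' "Le (lift_tm s) (Var 0)"] by (simp add: inst_def)

section \<open>Bounded quantifiers\<close>

definition BAll :: "tm \<Rightarrow> fm \<Rightarrow> fm" where
  "BAll t \<phi> = Forall (Imp (Le (Var 0) (lift_tm t)) \<phi>)"

text \<open>Defined by negation, so that \<open>decides_BAll\<close> and \<open>decides_Imp\<close>
  cover this quantifier as well.\<close>

abbreviation BEx :: "tm \<Rightarrow> fm \<Rightarrow> fm" where
  "BEx t \<phi> \<equiv> Neg (BAll t (Neg \<phi>))"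

lemma fv_BAll [simp]: "fv (BAll t \<phi>) = fv_tm t \<union> {n. Suc n \<in> fv \<phi>}"
  by (auto simp: BAll_def)

lemma sat_BAll [simp]: "sat e (BAll t \<phi>) \<longleftrightarrow> (\<forall>k\<le>val e t. sat (case_nat k e) \<phi>)"
  by (auto simp: BAll_def)

lemma ForallE2:
  assumes "\<Gamma> \<turnstile> Forall (Forall \<phi>)" shows "\<Gamma> \<turnstile> subst (case_nat s (case_nat t Var)) \<phi>"
proof -
  have "\<Gamma> \<turnstile> Forall (subst (up (case_nat t Var)) \<phi>)"
    using ForallE[OF assms, of t] by (simp add: inst_def)
  from ForallE[OF this, of s] show ?thesis by (simp only: inst_subst_up)
qed

text \<open>Stated under a substitution, so that the chosen term is just pushed onto
  \<open>\<theta>\<close> and the rule applies again to a nested quantifier.\<close>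

lemma BAllE:
  assumes "\<Gamma> \<turnstile> subst \<theta> (BAll t \<phi>)" "\<Gamma> \<turnstile> Le s (subst_tm \<theta> t)"
  shows "\<Gamma> \<turnstile> subst (case_nat s \<theta>) \<phi>"
proof -
  have "\<Gamma> \<turnstile> Forall (Imp (Le (Var 0) (lift_tm (subst_tm \<theta> t))) (subst (up \<theta>) \<phi>))"
    using assms(1) by (simp add: BAll_def)
  from ForallE[OF this, of s]
  have "\<Gamma> \<turnstile> Imp (Le s (subst_tm \<theta> t)) (inst (subst (up \<theta>) \<phi>) s)"
    by (simp add: inst_def)
  from ImpE[OF this assms(2)] show ?thesis by (simp only: inst_subst_up)
qed

lemma inst_eq: "inst \<phi> t = subst \<theta> \<phi>" if "fv \<phi> \<subseteq> {0}" "\<theta> 0 = t"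
  unfolding inst_def by (rule subst_cong) (use that in auto)

section \<open>Numerals and their order in contexts above \<open>T\<close>\<close>

locale Q_theory =
  fixes T :: "fm set"
  assumes closed: "arith_theory T" and Q: "extends_Q T"
begin

text \<open>The axioms are sentences, so a context above \<open>T\<close> stays above
  \<open>T\<close> when \<open>ForallI\<close> or \<open>ExE\<close> lifts it. The rules below are
  therefore stated for every such context.\<close>

lemma lift_T [simp]: "lift ` T = T"
proof -
  have "lift \<phi> = \<phi>" if "\<phi> \<in> T" for \<phi>
    using that closed by (simp add: arith_theory_def lift_sentence)
  then show ?thesis by simp
qed

lemma subset_lift: "T \<subseteq> \<Gamma> \<Longrightarrow> T \<subseteq> lift ` \<Gamma>"
  using image_mono[of T \<Gamma> lift] by simp

context
  fixes \<Gamma> :: "fm set"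
  assumes \<Gamma>: "T \<subseteq> \<Gamma>"
begin

lemma Q_axiom: "\<phi> \<in> robinson_Q \<Longrightarrow> \<Gamma> \<turnstile> \<phi>"
  using Q weaken[OF _ \<Gamma>] by (simp add: extends_Q_def)

lemma Succ_neq_Zero: "\<Gamma> \<turnstile> Neg (Eq (Succ t) Zero)"
proof -
  have "\<Gamma> \<turnstile> Forall (Neg (Eq (Succ (Var 0)) Zero))"
    by (rule Q_axiom) (simp add: robinson_Q_def)
  from ForallE[OF this, of t] show ?thesis by (simp add: inst_def)
qed

lemma Succ_inject:
  assumes "\<Gamma> \<turnstile> Eq (Succ s) (Succ t)" shows "\<Gamma> \<turnstile> Eq s t"
proof -
  have "\<Gamma> \<turnstile> Forall (Forall (Imp (Eq (Succ (Var 0)) (Succ (Var 1))) (Eq (Var 0) (Var 1))))"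
    by (rule Q_axiom) (simp add: robinson_Q_def)
  from ForallE2[OF this, of s t] have "\<Gamma> \<turnstile> Imp (Eq (Succ s) (Succ t)) (Eq s t)" by simp
  then show ?thesis using assms by (rule ImpE)
qed

lemma Zero_or_Succ: "\<Gamma> \<turnstile> Disj (Eq t Zero) (Exists (Eq (lift_tm t) (Succ (Var 0))))"
proof -
  have "\<Gamma> \<turnstile> Forall (Disj (Eq (Var 0) Zero) (Exists (Eq (Var 1) (Succ (Var 0)))))"
    by (rule Q_axiom) (simp add: robinson_Q_def)
  from ForallE[OF this, of t] show ?thesis by (simp add: inst_def)
qed

lemma Plus_Zero: "\<Gamma> \<turnstile> Eq (Plus t Zero) t"
proof -
  have "\<Gamma> \<turnstile> Forall (Eq (Plus (Var 0) Zero) (Var 0))"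
    by (rule Q_axiom) (simp add: robinson_Q_def)
  from ForallE[OF this, of t] show ?thesis by (simp add: inst_def)
qed

lemma Plus_Succ: "\<Gamma> \<turnstile> Eq (Plus s (Succ t)) (Succ (Plus s t))"
proof -
  have "\<Gamma> \<turnstile> Forall (Forall (Eq (Plus (Var 0) (Succ (Var 1))) (Succ (Plus (Var 0) (Var 1)))))"
    by (rule Q_axiom) (simp add: robinson_Q_def)
  from ForallE2[OF this, of s t] show ?thesis by simp
qed

lemma Times_Zero: "\<Gamma> \<turnstile> Eq (Times t Zero) Zero"
proof -
  have "\<Gamma> \<turnstile> Forall (Eq (Times (Var 0) Zero) Zero)"
    by (rule Q_axiom) (simp add: robinson_Q_def)
  from ForallE[OF this, of t] show ?thesis by (simp add: inst_def)
qed

lemma Times_Succ: "\<Gamma> \<turnstile> Eq (Times s (Succ t)) (Plus (Times s t) s)"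
proof -
  have "\<Gamma> \<turnstile> Forall (Forall (Eq (Times (Var 0) (Succ (Var 1))) (Plus (Times (Var 0) (Var 1)) (Var 0))))"
    by (rule Q_axiom) (simp add: robinson_Q_def)
  from ForallE2[OF this, of s t] show ?thesis by simp
qed

lemma Plus_numeral: "\<Gamma> \<turnstile> Eq (Plus (numeral_tm m) (numeral_tm n)) (numeral_tm (m + n))"
proof (induction n)
  case 0
  show ?case using Plus_Zero by simp
next
  case (Suc n)
  show ?case using eq_trans[OF Plus_Succ eq_Succ[OF Suc]] by simp
qed

lemma Times_numeral: "\<Gamma> \<turnstile> Eq (Times (numeral_tm m) (numeral_tm n)) (numeral_tm (m * n))"
proof (induction n)
  case 0
  show ?case using Times_Zero by simp
next
  case (Suc n)
  have "\<Gamma> \<turnstile> Eq (Plus (Times (numeral_tm m) (numeral_tm n)) (numeral_tm m)) (numeral_tm (m * n + m))"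
    by (rule eq_trans[OF eq_Plus[OF Suc EqRefl] Plus_numeral])
  then show ?case using eq_trans[OF Times_Succ] by (simp add: add.commute)
qed

lemma eval: "\<Gamma> \<turnstile> Eq (subst_tm (\<lambda>n. numeral_tm (e n)) t) (numeral_tm (val e t))"
proof (induction t)
  case (Plus s t)
  then show ?case using eq_trans[OF eq_Plus Plus_numeral] by simp
next
  case (Times s t)
  then show ?case using eq_trans[OF eq_Times Times_numeral] by simp
qed (simp_all add: EqRefl eq_Succ)

lemma numeral_neq: "m \<noteq> n \<Longrightarrow> \<Gamma> \<turnstile> Neg (Eq (numeral_tm m) (numeral_tm n))"
proof (induction m arbitrary: n)
  case 0
  then obtain k where n: "n = Suc k" by (cases n) auto
  let ?E = "Eq Zero (Succ (numeral_tm k))"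
  have "insert ?E \<Gamma> \<turnstile> Eq (Succ (numeral_tm k)) Zero"
    by (rule eq_sym) (simp add: Assm)
  then have "insert ?E \<Gamma> \<turnstile> Falsum"
    by (rule ImpE[OF weaken_insert[OF Succ_neq_Zero]])
  then show ?case unfolding n by (auto intro: ImpI)
next
  case (Suc m)
  show ?case
  proof (cases n)
    case 0
    then show ?thesis using Succ_neq_Zero by simp
  next
    case (Suc k)
    let ?E = "Eq (Succ (numeral_tm m)) (Succ (numeral_tm k))"
    have "insert ?E \<Gamma> \<turnstile> Eq (numeral_tm m) (numeral_tm k)"
      by (rule Q_theory.Succ_inject[OF Q_theory_axioms]) (use \<Gamma> in \<open>auto simp: Assm\<close>)
    moreover have "insert ?E \<Gamma> \<turnstile> Neg (Eq (numeral_tm m) (numeral_tm k))"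
      by (rule weaken_insert) (use Suc.IH Suc.prems \<open>n = Suc k\<close> in simp)
    ultimately have "insert ?E \<Gamma> \<turnstile> Falsum" by (rule ImpE[rotated])
    then show ?thesis unfolding Suc by (auto intro: ImpI)
  qed
qed

lemma Le_numeral: "m \<le> n \<Longrightarrow> \<Gamma> \<turnstile> Le (numeral_tm m) (numeral_tm n)"
  using Plus_numeral[of "n - m" m] by (intro LeI[where u = "numeral_tm (n - m)"]) simp

end

text \<open>The predecessor axiom as an elimination rule, with the predecessor as index 0. Together
  with external induction on numerals it stands in for induction in \<open>Q\<close>.\<close>

lemma Succ_cases:
  assumes "T \<subseteq> \<Gamma>" "insert (Eq t Zero) \<Gamma> \<turnstile> \<phi>"
    and "insert (Eq (lift_tm t) (Succ (Var 0))) (lift ` \<Gamma>) \<turnstile> lift \<phi>"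
  shows "\<Gamma> \<turnstile> \<phi>"
proof (rule DisjE[OF Zero_or_Succ[OF assms(1)] assms(2)])
  let ?E = "Exists (Eq (lift_tm t) (Succ (Var 0)))"
  show "insert ?E \<Gamma> \<turnstile> \<phi>"
  proof (rule ExE)
    show "insert ?E \<Gamma> \<turnstile> ?E" by (simp add: Assm)
  qed (rule weaken[OF assms(3)], auto)
qed

lemma Le_Succ:
  assumes "T \<subseteq> \<Gamma>" "\<Gamma> \<turnstile> Le s t" shows "\<Gamma> \<turnstile> Le (Succ s) (Succ t)"
  using assms(2)
proof (rule LeE)
  let ?\<Delta> = "insert (Eq (Plus (Var 0) (lift_tm s)) (lift_tm t)) (lift ` \<Gamma>)"
  have "T \<subseteq> ?\<Delta>" using subset_lift[OF assms(1)] by auto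
  moreover have "?\<Delta> \<turnstile> Eq (Succ (Plus (Var 0) (lift_tm s))) (Succ (lift_tm t))"
    by (rule eq_Succ) (simp add: Assm)
  ultimately have "?\<Delta> \<turnstile> Eq (Plus (Var 0) (Succ (lift_tm s))) (Succ (lift_tm t))"
    using eq_trans[OF Plus_Succ] by blast
  then show "?\<Delta> \<turnstile> lift (Le (Succ s) (Succ t))"
    by (simp add: LeI)
qed

text \<open>External induction on \<open>n\<close>, with a case distinction on \<open>t\<close>
  inside \<open>Q\<close>: if \<open>t\<close> is the successor of \<open>v\<close>, then
  \<open>u + v\<close> equals the predecessor of the numeral, and for \<open>n = 0\<close> a
  successor would equal zero.\<close>

lemma Plus_numeral_cases:
  assumes "T \<subseteq> \<Gamma>" "\<Gamma> \<turnstile> Eq (Plus u t) (numeral_tm n)"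
    and "\<And>k. k \<le> n \<Longrightarrow> insert (Eq t (numeral_tm k)) \<Gamma> \<turnstile> \<phi>"
  shows "\<Gamma> \<turnstile> \<phi>"
  using assms
proof (induction n arbitrary: u t \<Gamma> \<phi>)
  case (0 u t)
  from 0(1) show ?case
  proof (rule Succ_cases)
    show "insert (Eq t Zero) \<Gamma> \<turnstile> \<phi>" using 0(3)[of 0] by simp
    let ?\<Delta> = "insert (Eq (lift_tm t) (Succ (Var 0))) (lift ` \<Gamma>)"
    have T: "T \<subseteq> ?\<Delta>" using subset_lift[OF 0(1)] by auto
    have "?\<Delta> \<turnstile> Eq (Plus (lift_tm u) (lift_tm t)) Zero"
      using weaken_insert[OF provable_lift[OF 0(2)]] by simp
    then have "?\<Delta> \<turnstile> Eq (Plus (lift_tm u) (Succ (Var 0))) Zero"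
      by (rule eq_trans[OF eq_Plus[OF EqRefl eq_sym], rotated]) (simp add: Assm)
    then have "?\<Delta> \<turnstile> Eq (Succ (Plus (lift_tm u) (Var 0))) Zero"
      by (rule eq_trans[OF eq_sym[OF Plus_Succ[OF T]]])
    then show "?\<Delta> \<turnstile> lift \<phi>"
      by (rule NegE[OF Succ_neq_Zero[OF T]])
  qed
next
  case (Suc n u t)
  from Suc.prems(1) show ?case
  proof (rule Succ_cases)
    show "insert (Eq t Zero) \<Gamma> \<turnstile> \<phi>" using Suc.prems(3)[of 0] by simp
    let ?\<Delta> = "insert (Eq (lift_tm t) (Succ (Var 0))) (lift ` \<Gamma>)"
    have T: "T \<subseteq> ?\<Delta>" using subset_lift[OF Suc.prems(1)] by auto
    have "?\<Delta> \<turnstile> Eq (Plus (lift_tm u) (lift_tm t)) (Succ (numeral_tm n))"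
      using weaken_insert[OF provable_lift[OF Suc.prems(2)]] by simp
    then have "?\<Delta> \<turnstile> Eq (Plus (lift_tm u) (Succ (Var 0))) (Succ (numeral_tm n))"
      by (rule eq_trans[OF eq_Plus[OF EqRefl eq_sym], rotated]) (simp add: Assm)
    then have "?\<Delta> \<turnstile> Eq (Succ (Plus (lift_tm u) (Var 0))) (Succ (numeral_tm n))"
      by (rule eq_trans[OF eq_sym[OF Plus_Succ[OF T]]])
    then have "?\<Delta> \<turnstile> Eq (Plus (lift_tm u) (Var 0)) (numeral_tm n)"
      by (rule Succ_inject[OF T])
    with T show "?\<Delta> \<turnstile> lift \<phi>"
    proof (rule Suc.IH)
      fix k assume "k \<le> n"
      let ?E = "Eq (Var 0) (numeral_tm k)"
      have "insert ?E ?\<Delta> \<turnstile> Eq (lift_tm t) (numeral_tm (Suc k))"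
        unfolding numeral_tm.simps
        by (rule eq_trans[OF _ eq_Succ[of _ "Var 0"]]) (simp_all add: Assm)
      moreover have "insert (Eq (lift_tm t) (numeral_tm (Suc k))) (lift ` \<Gamma>) \<turnstile> lift \<phi>"
        using provable_lift[OF Suc.prems(3)[of "Suc k"]] \<open>k \<le> n\<close> by simp
      then have "insert (Eq (lift_tm t) (numeral_tm (Suc k))) (insert ?E ?\<Delta>) \<turnstile> lift \<phi>"
        by (rule weaken) auto
      ultimately show "insert ?E ?\<Delta> \<turnstile> lift \<phi>" by (rule cut)
    qed
  qed
qed

lemma Le_numeral_cases:
  assumes \<Gamma>: "T \<subseteq> \<Gamma>" and le: "\<Gamma> \<turnstile> Le t (numeral_tm n)"
    and cases: "\<And>k. k \<le> n \<Longrightarrow> insert (Eq t (numeral_tm k)) \<Gamma> \<turnstile> \<phi>"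
  shows "\<Gamma> \<turnstile> \<phi>"
  using le
proof (rule LeE)
  let ?E = "Eq (Plus (Var 0) (lift_tm t)) (lift_tm (numeral_tm n))"
  let ?\<Delta> = "insert ?E (lift ` \<Gamma>)"
  show "?\<Delta> \<turnstile> lift \<phi>"
  proof (rule Plus_numeral_cases)
    show "T \<subseteq> ?\<Delta>" using subset_lift[OF \<Gamma>] by auto
    show "?\<Delta> \<turnstile> Eq (Plus (Var 0) (lift_tm t)) (numeral_tm n)" by (simp add: Assm)
    fix k assume "k \<le> n"
    from provable_lift[OF cases[OF this]]
    show "insert (Eq (lift_tm t) (numeral_tm k)) ?\<Delta> \<turnstile> lift \<phi>"
      by (rule weaken) auto
  qed
qed

text \<open>Two nonstandard elements of a model of \<open>Q\<close> may be incomparable, so one side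
  has to be a numeral. External induction on it, with a case distinction on \<open>t\<close>,
  reduces successors by \<open>Le_Succ\<close>.\<close>

lemma Le_total:
  "T \<subseteq> \<Gamma> \<Longrightarrow> \<Gamma> \<turnstile> Disj (Le t (numeral_tm n)) (Le (numeral_tm n) t)"
proof (induction n arbitrary: t \<Gamma>)
  case 0
  then show ?case by (intro DisjI2 LeI[where u = t]) (simp add: Plus_Zero)
next
  case (Suc n)
  let ?n = "numeral_tm n"
  from Suc.prems show ?case
  proof (rule Succ_cases)
    let ?\<Delta> = "insert (Eq t Zero) \<Gamma>"
    have T: "T \<subseteq> ?\<Delta>" using Suc.prems by auto
    have "?\<Delta> \<turnstile> Le t (Succ ?n)"
    proof (rule Le_cong_left)
      show "?\<Delta> \<turnstile> Eq Zero t" by (rule eq_sym) (simp add: Assm)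
      show "?\<Delta> \<turnstile> Le Zero (Succ ?n)" by (rule LeI[OF Plus_Zero[OF T]])
    qed
    then show "?\<Delta> \<turnstile> Disj (Le t (numeral_tm (Suc n))) (Le (numeral_tm (Suc n)) t)"
      unfolding numeral_tm.simps by (rule DisjI1)
  next
    let ?\<Delta> = "insert (Eq (lift_tm t) (Succ (Var 0))) (lift ` \<Gamma>)"
    let ?\<phi> = "Disj (Le (lift_tm t) (Succ ?n)) (Le (Succ ?n) (lift_tm t))"
    have T: "T \<subseteq> insert \<psi> ?\<Delta>" for \<psi> using subset_lift[OF Suc.prems] by auto
    have eq: "insert \<psi> ?\<Delta> \<turnstile> Eq (Succ (Var 0)) (lift_tm t)" for \<psi>
      by (rule eq_sym) (simp add: Assm)
    have "?\<Delta> \<turnstile> Disj (Le (Var 0) ?n) (Le ?n (Var 0))"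
      by (rule Suc.IH) (use subset_lift[OF Suc.prems] in auto)
    then have "?\<Delta> \<turnstile> ?\<phi>"
    proof (rule DisjE)
      show "insert (Le (Var 0) ?n) ?\<Delta> \<turnstile> ?\<phi>"
        by (rule DisjI1, rule Le_cong_left[OF eq], rule Le_Succ[OF T]) (simp add: Assm)
      show "insert (Le ?n (Var 0)) ?\<Delta> \<turnstile> ?\<phi>"
        by (rule DisjI2, rule Le_cong_right[OF eq], rule Le_Succ[OF T]) (simp add: Assm)
    qed
    then show "?\<Delta> \<turnstile> lift (Disj (Le t (numeral_tm (Suc n))) (Le (numeral_tm (Suc n)) t))"
      by simp
  qed
qed


section \<open>Formulas decided at numerals\<close>

text \<open>The form of completeness that \<open>Q\<close> offers. The closure lemmas cover
  equations, \<open>Le\<close>, the connectives and bounded quantifiers, which suffices for the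
  whole coding.\<close>

definition decides :: "fm \<Rightarrow> bool" where
  "decides \<phi> \<longleftrightarrow> (\<forall>e. (sat e \<phi> \<longrightarrow> T \<turnstile> subst (\<lambda>n. numeral_tm (e n)) \<phi>) \<and>
    (\<not> sat e \<phi> \<longrightarrow> T \<turnstile> Neg (subst (\<lambda>n. numeral_tm (e n)) \<phi>)))"

lemma decidesI:
  assumes "\<And>e. sat e \<phi> \<Longrightarrow> T \<turnstile> subst (\<lambda>n. numeral_tm (e n)) \<phi>"
    and "\<And>e. \<not> sat e \<phi> \<Longrightarrow> insert (subst (\<lambda>n. numeral_tm (e n)) \<phi>) T \<turnstile> Falsum"
  shows "decides \<phi>"
  unfolding decides_def using assms ImpI by blast

lemma decides_true: "decides \<phi> \<Longrightarrow> sat e \<phi> \<Longrightarrow> T \<turnstile> subst (\<lambda>n. numeral_tm (e n)) \<phi>"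
  and decides_false: "decides \<phi> \<Longrightarrow> \<not> sat e \<phi> \<Longrightarrow> T \<turnstile> Neg (subst (\<lambda>n. numeral_tm (e n)) \<phi>)"
  by (simp_all add: decides_def)

lemma decides_Falsum [simp]: "decides Falsum"
  by (rule decidesI) (simp_all add: Assm)

lemma decides_Imp [simp]:
  assumes "decides \<phi>" "decides \<psi>" shows "decides (Imp \<phi> \<psi>)"
  unfolding decides_def
proof (intro allI conjI impI)
  fix e
  let ?s = "subst (\<lambda>n. numeral_tm (e n))"
  show "T \<turnstile> ?s (Imp \<phi> \<psi>)" if sat: "sat e (Imp \<phi> \<psi>)"
  proof (cases "sat e \<phi>")
    case True
    with sat have "T \<turnstile> ?s \<psi>" by (simp add: decides_true assms)
    then show ?thesis by (simp add: ImpI weaken_insert)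
  next
    case False
    then have "insert (?s \<phi>) T \<turnstile> Neg (?s \<phi>)" by (simp add: weaken_insert decides_false assms)
    then have "insert (?s \<phi>) T \<turnstile> ?s \<psi>" by (rule NegE) (simp add: Assm)
    then show ?thesis by (simp add: ImpI)
  qed
  show "T \<turnstile> Neg (?s (Imp \<phi> \<psi>))" if "\<not> sat e (Imp \<phi> \<psi>)"
    using that by (simp add: Neg_Imp_iff decides_true decides_false assms)
qed

lemma decides_Eq [simp]: "decides (Eq s t)"
proof (rule decidesI)
  fix e
  let ?s = "subst_tm (\<lambda>n. numeral_tm (e n))"
  note ev = eval[where e = e]
  have "T \<turnstile> Eq (?s s) (?s t)" if "val e s = val e t"
    using eq_trans[OF ev[of _ s] eq_sym[OF ev[of _ t, folded that]]] by simp
  then show "T \<turnstile> subst (\<lambda>n. numeral_tm (e n)) (Eq s t)" if "sat e (Eq s t)"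
    using that by simp
  let ?\<Delta> = "insert (Eq (?s s) (?s t)) T"
  have T: "T \<subseteq> ?\<Delta>" by auto
  have "?\<Delta> \<turnstile> Eq (?s s) (?s t)" by (simp add: Assm)
  then have eq: "?\<Delta> \<turnstile> Eq (numeral_tm (val e s)) (numeral_tm (val e t))"
    by (rule eq_trans[OF eq_trans[OF eq_sym[OF ev[OF T]]] ev[OF T]])
  show "insert (subst (\<lambda>n. numeral_tm (e n)) (Eq s t)) T \<turnstile> Falsum" if "\<not> sat e (Eq s t)"
    using NegE[OF numeral_neq[OF T] eq] that by simp
qed

text \<open>\<open>Le\<close> hides an unbounded quantifier, so closure under bounded ones does not
  reach it. A false instance is refuted by equating its left side with each numeral up to the right
  side.\<close>

lemma decides_Le [simp]: "decides (Le s t)"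
proof (rule decidesI)
  fix e
  let ?s = "subst_tm (\<lambda>n. numeral_tm (e n))"
  note ev = eval[where e = e]
  show "T \<turnstile> subst (\<lambda>n. numeral_tm (e n)) (Le s t)" if "sat e (Le s t)"
    using that Le_cong_left[OF eq_sym[OF ev] Le_cong_right[OF eq_sym[OF ev] Le_numeral]] by simp
  let ?\<Delta> = "insert (Le (?s s) (?s t)) T"
  have T: "T \<subseteq> ?\<Delta>" by auto
  have le: "?\<Delta> \<turnstile> Le (numeral_tm (val e s)) (numeral_tm (val e t))"
    by (rule Le_cong_left[OF ev[OF T]], rule Le_cong_right[OF ev[OF T]]) (simp add: Assm)
  have "?\<Delta> \<turnstile> Falsum" if "\<not> sat e (Le s t)"
  proof (rule Le_numeral_cases[OF T le])
    fix k assume k: "k \<le> val e t"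
    let ?E = "Eq (numeral_tm (val e s)) (numeral_tm k)"
    have "insert ?E ?\<Delta> \<turnstile> Neg ?E"
      by (rule numeral_neq) (use k that in auto)
    then show "insert ?E ?\<Delta> \<turnstile> Falsum"
      by (rule NegE) (simp add: Assm)
  qed
  then show "insert (subst (\<lambda>n. numeral_tm (e n)) (Le s t)) T \<turnstile> Falsum" if "\<not> sat e (Le s t)"
    using that by simp
qed

lemma numeral_case_nat:
  "(\<lambda>n. numeral_tm (case_nat k e n)) = (up (\<lambda>n. numeral_tm (e n)))(0 := numeral_tm k)"
  by (auto split: nat.split)

lemma inst_up_numeral:
  "inst (subst (up (\<lambda>n. numeral_tm (e n))) \<phi>) (numeral_tm k) = subst (\<lambda>n. numeral_tm (case_nat k e n)) \<phi>"
  unfolding inst_subst_up by (rule subst_cong) (simp split: nat.split)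

text \<open>If true, the bounded variable equals one of finitely many numerals by
  \<open>Le_numeral_cases\<close>, and \<open>subst_eq\<close> carries the proved instance back to
  the variable. If false, a counterexample gives a refutable instance.\<close>

lemma decides_BAll [simp]:
  assumes "decides \<phi>" shows "decides (BAll t \<phi>)"
proof (rule decidesI)
  fix e :: "nat \<Rightarrow> nat"
  let ?e = "\<lambda>n. numeral_tm (e n :: nat)"
  let ?t = "subst_tm ?e t" and ?\<phi> = "subst (up ?e) \<phi>"
  have lift_t: "lift_tm ?t = ?t" unfolding subst_tm_comp by simp
  have eq: "\<Gamma> \<turnstile> Eq (lift_tm ?t) (numeral_tm (val e t))" if "T \<subseteq> \<Gamma>" for \<Gamma>
    unfolding lift_t using that by (rule eval)
  show "T \<turnstile> subst ?e (BAll t \<phi>)" if sat: "sat e (BAll t \<phi>)"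
  proof -
    let ?\<Delta> = "insert (Le (Var 0) (lift_tm ?t)) T"
    have T: "T \<subseteq> ?\<Delta>" by auto
    have "?\<Delta> \<turnstile> Le (Var 0) (numeral_tm (val e t))"
      by (rule Le_cong_right[OF eq[OF T]]) (simp add: Assm)
    then have "?\<Delta> \<turnstile> ?\<phi>"
    proof (rule Le_numeral_cases[OF T])
      fix k assume "k \<le> val e t"
      with sat have "T \<turnstile> subst (\<lambda>n. numeral_tm (case_nat k e n)) \<phi>"
        by (intro decides_true assms) simp
      then have "insert (Eq (Var 0) (numeral_tm k)) ?\<Delta> \<turnstile> subst ((up ?e)(0 := numeral_tm k)) \<phi>"
        unfolding numeral_case_nat by (rule weaken) auto
      then have "insert (Eq (Var 0) (numeral_tm k)) ?\<Delta> \<turnstile> subst ((up ?e)(0 := Var 0)) \<phi>"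
        by (rule subst_eq[OF eq_sym, rotated]) (simp add: Assm)
      then show "insert (Eq (Var 0) (numeral_tm k)) ?\<Delta> \<turnstile> ?\<phi>"
        by (simp add: fun_upd_idem)
    qed
    then have "lift ` T \<turnstile> Imp (Le (Var 0) (lift_tm ?t)) ?\<phi>" by (simp add: ImpI)
    then show ?thesis by (simp add: BAll_def ForallI lift_t)
  qed
  show "insert (subst ?e (BAll t \<phi>)) T \<turnstile> Falsum" if nsat: "\<not> sat e (BAll t \<phi>)"
  proof -
    from nsat obtain k where k: "k \<le> val e t" "\<not> sat (case_nat k e) \<phi>" by auto
    let ?\<Delta> = "insert (subst ?e (BAll t \<phi>)) T"
    have T: "T \<subseteq> ?\<Delta>" by auto
    have "?\<Delta> \<turnstile> Forall (Imp (Le (Var 0) (lift_tm ?t)) ?\<phi>)"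
      by (simp add: Assm BAll_def lift_t)
    from ForallE[OF this, of "numeral_tm k"]
    have "?\<Delta> \<turnstile> Imp (Le (numeral_tm k) ?t) (inst ?\<phi> (numeral_tm k))"
      by (simp add: inst_def)
    moreover have "?\<Delta> \<turnstile> Le (numeral_tm k) ?t"
      by (rule Le_cong_right[OF eq_sym[OF eval[OF T]] Le_numeral[OF T k(1)]])
    ultimately have "?\<Delta> \<turnstile> inst ?\<phi> (numeral_tm k)" by (rule ImpE)
    moreover have "T \<turnstile> Neg (inst ?\<phi> (numeral_tm k))"
      unfolding inst_up_numeral by (rule decides_false[OF assms k(2)])
    ultimately show ?thesis by (rule ImpE[OF weaken_insert, rotated])
  qed
qed

text \<open>Needed for the permuted copy of \<open>\<delta>\<close> in \<open>least_witness\<close>: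
  renaming a numeral environment gives a numeral environment again.\<close>

lemma decides_rename:
  assumes "decides \<phi>" shows "decides (subst (\<lambda>n. Var (r n)) \<phi>)"
  using assms unfolding decides_def sat_subst subst_comp by simp

end


section \<open>Diagonalization\<close>

abbreviation env3 :: "'a \<Rightarrow> 'a \<Rightarrow> 'a \<Rightarrow> nat \<Rightarrow> 'a" where
  "env3 w y x \<equiv> case_nat w (case_nat y (\<lambda>_. x))"

text \<open>Here \<open>\<delta>\<close> has the variables 0 (a witness \<open>w\<close>), 1 (the value \<open>y\<close>) and 2 (the argument \<open>x\<close>).
  Asking \<open>w\<close> to be the least witness makes uniqueness of the value provable in \<open>Q\<close>: a
  nonstandard \<open>w\<close> is refuted by comparing it with the standard one.\<close>

definition least_witness :: "fm \<Rightarrow> fm" where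
  "least_witness \<delta> = Conj \<delta> (Conj (Le (Var 1) (Var 0))
    (BAll (Var 0) (BAll (Var 0) (Imp
      (subst (\<lambda>n. Var (if n = 0 then 1 else if n = 1 then 0 else n + 2)) \<delta>)
      (Eq (Var 1) (Var 2))))))"

lemma fv_least_witness:
  assumes "fv \<delta> \<subseteq> {0, 1, 2}" shows "fv (least_witness \<delta>) \<subseteq> {0, 1, 2}"
  using assms by (auto simp: least_witness_def fv_subst split: if_splits)

lemma sat_least_witness:
  "sat e (least_witness \<delta>) \<longleftrightarrow> sat e \<delta> \<and> e 1 \<le> e 0 \<and>
    (\<forall>w\<le>e 0. \<forall>y\<le>w. sat (case_nat w (case_nat y (\<lambda>n. e (n + 2)))) \<delta> \<longrightarrow> w = e 0)"
proof -
  \<comment> \<open>The competing witness is bound before its value: in the copy of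
    \<open>\<delta>\<close> they are the indices 1 and 0, and the argument moves from 2 to
    4.\<close>
  have *: "(\<lambda>n. case_nat y (case_nat w e) (if n = 0 then 1 else if n = 1 then 0 else n + 2)) =
    case_nat w (case_nat y (\<lambda>n. e (n + 2)))" for y w
    by (auto split: nat.split)
  show ?thesis
    unfolding least_witness_def by (simp add: sat_subst * del: One_nat_def) simp
qed

text \<open>Witnesses certify only correct values. One that reaches the value must exist because
  \<open>least_witness\<close> demands that the value be at most the witness.\<close>

locale representation = Q_theory +
  fixes \<delta> :: fm and f :: "nat \<Rightarrow> nat"
  assumes decides_graph: "decides \<delta>"
    and fv_graph: "fv \<delta> \<subseteq> {0, 1, 2}"
    and graph_value: "sat e \<delta> \<Longrightarrow> e 1 = f (e 2)"
    and graph_witness: "\<exists>w\<ge>f x. sat (env3 w (f x) x) \<delta>"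
begin

definition wit :: "nat \<Rightarrow> nat" where
  "wit x = (LEAST w. f x \<le> w \<and> sat (env3 w (f x) x) \<delta>)"

lemma wit: "f x \<le> wit x" "sat (env3 (wit x) (f x) x) \<delta>"
proof -
  have "f x \<le> wit x \<and> sat (env3 (wit x) (f x) x) \<delta>"
    unfolding wit_def by (rule LeastI_ex) (use graph_witness in blast)
  then show "f x \<le> wit x" "sat (env3 (wit x) (f x) x) \<delta>" by auto
qed

lemma wit_le: "f x \<le> w \<Longrightarrow> sat (env3 w (f x) x) \<delta> \<Longrightarrow> wit x \<le> w"
  unfolding wit_def by (rule Least_le) simp

abbreviation term_env :: "tm \<Rightarrow> tm \<Rightarrow> nat \<Rightarrow> nat \<Rightarrow> tm" where
  "term_env w y x \<equiv> env3 w y (numeral_tm x)"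

lemma numeral_env3:
  "(\<lambda>n. numeral_tm (env3 w y x n)) = term_env (numeral_tm w) (numeral_tm y) x"
  by (auto split: nat.split)

lemma provable_least_witness:
  "T \<turnstile> subst (term_env (numeral_tm (wit x)) (numeral_tm (f x)) x) (least_witness \<delta>)"
proof -
  have "w = wit x" if "w \<le> wit x" "y \<le> w" "sat (env3 w y x) \<delta>" for w y
  proof -
    \<comment> \<open>Only the right value has witnesses, so competing with all pairs
      \<open>(w, y)\<close> amounts to competing with witnesses of \<open>f x\<close>.\<close>
    have "y = f x" using graph_value[OF that(3)] by (simp add: numeral_2_eq_2)
    then show ?thesis using wit_le[of x w] that by simp
  qed
  then have "sat (env3 (wit x) (f x) x) (least_witness \<delta>)"
    using wit[of x] by (auto simp: sat_least_witness)
  moreover have "decides (least_witness \<delta>)"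
    unfolding least_witness_def by (simp add: decides_graph decides_rename)
  ultimately show ?thesis
    using decides_true[of _ "env3 (wit x) (f x) x"] by (simp only: numeral_env3)
qed

text \<open>Once \<open>w\<close> is bounded by the standard least witness, it is one of finitely
  many numerals, and by \<open>y \<le> w\<close> so is \<open>y\<close>. At numerals
  \<open>\<delta>\<close> is decided, so a wrong value is refuted. This is why the value is bounded
  by the witness.\<close>

lemma least_witness_unique:
  assumes T: "T \<subseteq> \<Gamma>" and lw: "\<Gamma> \<turnstile> subst (term_env w y x) (least_witness \<delta>)"
  shows "\<Gamma> \<turnstile> Eq y (numeral_tm (f x))"
proof -
  let ?w = "numeral_tm (wit x)" and ?y = "numeral_tm (f x)"
  let ?\<delta> = "subst (\<lambda>n. Var (if n = 0 then 1 else if n = 1 then 0 else n + 2)) \<delta>"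
  let ?min = "BAll (Var 0) (BAll (Var 0) (Imp ?\<delta> (Eq (Var 1) (Var 2))))"
  from lw have graph: "\<Gamma> \<turnstile> subst (term_env w y x) \<delta>"
    and yw: "\<Gamma> \<turnstile> Le y w" and min: "\<Gamma> \<turnstile> subst (term_env w y x) ?min"
    unfolding least_witness_def subst.simps Conj_iff by simp_all
  have "\<Gamma> \<turnstile> Le w ?w"
  proof (rule DisjE[OF Le_total[OF T]])
    show "insert (Le w ?w) \<Gamma> \<turnstile> Le w ?w" by (simp add: Assm)
    let ?\<Delta> = "insert (Le ?w w) \<Gamma>"
    have T': "T \<subseteq> ?\<Delta>" using T by auto
    \<comment> \<open>The minimality of \<open>w\<close>, applied to the standard witness and value,
      yields that \<open>w\<close> equals \<open>wit x\<close>.\<close>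
    have "?\<Delta> \<turnstile> subst (case_nat ?w (term_env w y x)) (BAll (Var 0) (Imp ?\<delta> (Eq (Var 1) (Var 2))))"
      by (rule BAllE[OF weaken_insert[OF min]]) (simp add: Assm)
    then have "?\<Delta> \<turnstile> subst (case_nat ?y (case_nat ?w (term_env w y x))) (Imp ?\<delta> (Eq (Var 1) (Var 2)))"
      by (rule BAllE) (simp add: Le_numeral[OF T'] wit)
    moreover have "subst (case_nat ?y (case_nat ?w (term_env w y x))) ?\<delta> = subst (term_env ?w ?y x) \<delta>"
      unfolding subst_comp by (rule subst_cong) (auto split: nat.split)
    ultimately have "?\<Delta> \<turnstile> Imp (subst (term_env ?w ?y x) \<delta>) (Eq ?w w)"
      by (simp add: numeral_2_eq_2)
    moreover have "?\<Delta> \<turnstile> subst (term_env ?w ?y x) \<delta>"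
      using decides_true[OF decides_graph wit(2)] weaken[OF _ T'] by (simp only: numeral_env3)
    ultimately have "?\<Delta> \<turnstile> Eq ?w w" by (rule ImpE)
    then show "?\<Delta> \<turnstile> Le w ?w" by (rule Le_cong_left) (simp add: Le_numeral[OF T'])
  qed
  then show ?thesis
  proof (rule Le_numeral_cases[OF T])
    fix k
    let ?\<Delta> = "insert (Eq w (numeral_tm k)) \<Gamma>"
    have "?\<Delta> \<turnstile> Le y (numeral_tm k)"
      by (rule Le_cong_right[OF _ weaken_insert[OF yw]]) (simp add: Assm)
    then show "?\<Delta> \<turnstile> Eq y ?y"
    proof (rule Le_numeral_cases[rotated])
      show "T \<subseteq> ?\<Delta>" using T by auto
      fix j
      let ?\<Theta> = "insert (Eq y (numeral_tm j)) ?\<Delta>"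
      have "?\<Theta> \<turnstile> subst ((term_env w y x)(0 := w)) \<delta>"
        using weaken_insert[OF weaken_insert[OF graph]] by (simp add: fun_upd_idem)
      then have "?\<Theta> \<turnstile> subst ((term_env w y x)(0 := numeral_tm k)) \<delta>"
        by (rule subst_eq[rotated]) (simp add: Assm)
      moreover have "(term_env w y x)(0 := numeral_tm k) = (term_env (numeral_tm k) y x)(1 := y)"
        by (auto split: nat.split)
      ultimately have "?\<Theta> \<turnstile> subst ((term_env (numeral_tm k) y x)(1 := y)) \<delta>"
        by simp
      then have "?\<Theta> \<turnstile> subst ((term_env (numeral_tm k) y x)(1 := numeral_tm j)) \<delta>"
        by (rule subst_eq[rotated]) (simp add: Assm)
      moreover have "(term_env (numeral_tm k) y x)(1 := numeral_tm j) = (\<lambda>n. numeral_tm (env3 k j x n))"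
        by (auto split: nat.split)
      ultimately have *: "?\<Theta> \<turnstile> subst (\<lambda>n. numeral_tm (env3 k j x n)) \<delta>" by simp
      show "?\<Theta> \<turnstile> Eq y ?y"
      proof (cases "j = f x")
        case True
        then show ?thesis by (simp add: Assm)
      next
        case False
        then have "\<not> sat (env3 k j x) \<delta>"
          using graph_value[of "env3 k j x"] by (auto simp: numeral_2_eq_2)
        from decides_false[OF decides_graph this]
        have "?\<Theta> \<turnstile> Neg (subst (\<lambda>n. numeral_tm (env3 k j x n)) \<delta>)"
          by (rule weaken) (use T in auto)
        then show ?thesis using * by (rule NegE)
      qed
    qed
  qed
qed

text \<open>\<open>\<chi>(x)\<close> says that whatever has a least witness at \<open>x\<close>
  satisfies \<open>\<psi>\<close>. Left to right uses the provable least witness of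
  \<open>f x\<close>, right to left the uniqueness of the value.\<close>

lemma represents:
  fixes \<psi> :: fm
  assumes \<psi>: "fv \<psi> \<subseteq> {0}"
  defines "\<chi> \<equiv> Forall (Imp (Exists (least_witness \<delta>)) \<psi>)"
  shows "T \<turnstile> Iff (inst \<chi> (numeral_tm x)) (inst \<psi> (numeral_tm (f x)))"
proof -
  let ?M = "subst (term_env (Var 0) (Var 1) x) (least_witness \<delta>)"
  let ?y = "numeral_tm (f x)"
  have M: "subst (up (up (case_nat (numeral_tm x) Var))) (least_witness \<delta>) = ?M"
    by (rule subst_cong) (use fv_least_witness[OF fv_graph] in \<open>auto split: nat.split\<close>)
  have "subst (up (case_nat (numeral_tm x) Var)) \<psi> = subst Var \<psi>"
    by (rule subst_cong) (use \<psi> in auto)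
  with M have inst: "inst \<chi> (numeral_tm x) = Forall (Imp (Exists ?M) \<psi>)"
    by (simp add: \<chi>_def inst_def)
  let ?N = "Forall (Imp (Exists ?M) \<psi>)"
  have "T \<turnstile> Imp ?N (inst \<psi> ?y)"
  proof (rule ImpI)
    let ?\<Delta> = "insert ?N T"
    have eq: "inst (subst (up (case_nat ?y Var)) ?M) (numeral_tm (wit x)) =
      subst (term_env (numeral_tm (wit x)) ?y x) (least_witness \<delta>)"
      unfolding inst_subst_up unfolding subst_comp by (rule subst_cong) (simp split: nat.split)
    have "?\<Delta> \<turnstile> ?N" by (simp add: Assm)
    from ForallE[OF this, of ?y]
    have "?\<Delta> \<turnstile> Imp (Exists (subst (up (case_nat ?y Var)) ?M)) (inst \<psi> ?y)"
      by (simp add: inst_def)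
    moreover have "?\<Delta> \<turnstile> Exists (subst (up (case_nat ?y Var)) ?M)"
      by (rule ExI[where t = "numeral_tm (wit x)"])
        (unfold eq, rule weaken_insert[OF provable_least_witness])
    ultimately show "?\<Delta> \<turnstile> inst \<psi> ?y" by (rule ImpE)
  qed
  moreover have "T \<turnstile> Imp (inst \<psi> ?y) ?N"
  proof (rule ImpI, rule ForallI, rule ImpI, rule ExE)
    let ?\<Gamma> = "insert (Exists ?M) (lift ` insert (inst \<psi> ?y) T)"
    let ?\<Delta> = "insert ?M (lift ` ?\<Gamma>)"
    show "?\<Gamma> \<turnstile> Exists ?M" by (simp add: Assm)
    have "T \<subseteq> lift ` ?\<Gamma>" by (rule subset_lift) auto
    then have "?\<Delta> \<turnstile> Eq (Var 1) ?y"
      by (intro least_witness_unique) (auto intro: Assm)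
    moreover have "?\<Delta> \<turnstile> inst \<psi> ?y"
      by (rule Assm) (simp add: lift_sentence[OF sentence_inst_numeral[OF \<psi>]])
    ultimately have "?\<Delta> \<turnstile> inst \<psi> (Var 1)" by (rule EqSubst[OF eq_sym])
    also have "inst \<psi> (Var 1) = lift \<psi>"
      unfolding lift_def by (rule inst_eq[OF \<psi>]) simp
    finally show "?\<Delta> \<turnstile> lift \<psi>" .
  qed
  ultimately show ?thesis unfolding inst Conj_iff ..
qed

end

context Q_theory
begin

text \<open>Lets the sentence on the left stand in for the application of \<open>\<chi>\<close> to
  its own code.\<close>

lemma Forall_eq_iff_inst:
  assumes "fv \<chi> \<subseteq> {0}"
  shows "T \<turnstile> Iff (Forall (Imp (Eq (Var 0) (numeral_tm n)) \<chi>)) (inst \<chi> (numeral_tm n))"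
  unfolding Conj_iff
proof (intro conjI ImpI)
  let ?G = "Forall (Imp (Eq (Var 0) (numeral_tm n)) \<chi>)"
  have "insert ?G T \<turnstile> ?G" by (simp add: Assm)
  from ForallE[OF this, of "numeral_tm n"]
  have "insert ?G T \<turnstile> Imp (Eq (numeral_tm n) (numeral_tm n)) (inst \<chi> (numeral_tm n))"
    by (simp add: inst_def)
  then show "insert ?G T \<turnstile> inst \<chi> (numeral_tm n)" by (rule ImpE) (rule EqRefl)
next
  let ?\<Gamma> = "insert (inst \<chi> (numeral_tm n)) T"
  let ?\<Delta> = "insert (Eq (Var 0) (numeral_tm n)) (lift ` ?\<Gamma>)"
  have "?\<Delta> \<turnstile> inst \<chi> (numeral_tm n)"
    by (rule Assm) (simp add: lift_sentence[OF sentence_inst_numeral[OF assms]])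
  then have "?\<Delta> \<turnstile> inst \<chi> (Var 0)"
    by (rule EqSubst[OF eq_sym, rotated]) (simp add: Assm)
  then have "?\<Delta> \<turnstile> \<chi>"
    using inst_eq[of \<chi> Var "Var 0"] assms by simp
  then show "?\<Gamma> \<turnstile> Forall (Imp (Eq (Var 0) (numeral_tm n)) \<chi>)"
    by (intro ForallI ImpI)
qed

end


section \<open>Goedel's beta function\<close>

definition beta :: "nat \<Rightarrow> nat \<Rightarrow> nat \<Rightarrow> nat" where
  "beta a b i = a mod Suc (Suc i * b)"

text \<open>A common prime divides the difference \<open>(j - i) * b\<close> but not
  \<open>b\<close>, since it would then divide 1. So it divides \<open>j - i\<close>, a divisor of
  \<open>fact n\<close> and hence of \<open>b\<close>: contradiction.\<close>

lemma coprime_beta_moduli: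
  assumes "i < j" "j \<le> n" "fact n dvd b"
  shows "coprime (Suc (Suc i * b)) (Suc (Suc j * b))"
proof (rule ccontr)
  assume "\<not> coprime (Suc (Suc i * b)) (Suc (Suc j * b))"
  then have "gcd (Suc (Suc i * b)) (Suc (Suc j * b)) \<noteq> 1"
    using coprime_iff_gcd_eq_1 by blast
  then obtain p where p: "prime p" "p dvd Suc (Suc i * b)" "p dvd Suc (Suc j * b)"
    using prime_factor_nat[of "gcd (Suc (Suc i * b)) (Suc (Suc j * b))"] by (auto simp del: mult_Suc)
  have "\<not> p dvd b"
  proof
    assume "p dvd b"
    then have "p dvd Suc i * b" by (rule dvd_mult)
    with p(2) have "p dvd 1" using dvd_diff_nat[of p "Suc (Suc i * b)" "Suc i * b"] by simp
    with p(1) show False by simp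
  qed
  moreover have "p dvd (j - i) * b"
  proof -
    have "p dvd Suc (Suc j * b) - Suc (Suc i * b)" by (rule dvd_diff_nat[OF p(3,2)])
    then show ?thesis using assms(1) by (simp add: diff_mult_distrib)
  qed
  ultimately have "p dvd j - i" using p(1) by (simp add: prime_dvd_mult_iff)
  also have "j - i dvd fact n" using assms(1,2) by (intro dvd_fact) auto
  finally show False using \<open>\<not> p dvd b\<close> assms(3) by (meson dvd_trans)
qed

lemma beta_surjective: "\<exists>a b. \<forall>i\<le>n. beta a b i = f i"
proof -
  \<comment> \<open>\<open>m\<close> is at least \<open>n\<close>, for coprimality, and at least
    every \<open>f i\<close>, so that the residues stay below the moduli.\<close>
  define m where "m = n + (\<Sum>i\<le>n. f i)"
  define b :: nat where "b = fact m"
  have "coprime (Suc (Suc i * b)) (Suc (Suc j * b))" if "i \<le> n" "j \<le> n" "i \<noteq> j" for i j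
  proof (cases "i < j")
    case True
    then show ?thesis
      using that by (intro coprime_beta_moduli[of i j m]) (simp_all add: b_def m_def)
  next
    case False
    then have "coprime (Suc (Suc j * b)) (Suc (Suc i * b))"
      using that by (intro coprime_beta_moduli[of j i m]) (simp_all add: b_def m_def)
    then show ?thesis by (simp only: coprime_commute)
  qed
  then obtain a where a: "\<forall>i\<in>{..n}. [a = f i] (mod Suc (Suc i * b))"
    using chinese_remainder_nat[of "{..n}" "\<lambda>i. Suc (Suc i * b)" f] by blast
  have "beta a b i = f i" if "i \<le> n" for i
  proof -
    have "f i \<le> (\<Sum>i\<le>n. f i)" using that by (intro member_le_sum) auto
    also have "\<dots> \<le> b" unfolding b_def m_def
      by (rule order_trans[OF _ fact_ge_self]) simp
    finally have "f i < Suc (Suc i * b)" by simp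
    then show ?thesis using a that by (simp add: beta_def cong_def del: mult_Suc)
  qed
  then show ?thesis by blast
qed

lemma beta_le: "beta a b i \<le> a"
  by (simp add: beta_def)

text \<open>Remainder expressed without division and with the quotient bounded by \<open>a\<close>,
  the shape that \<open>Beta\<close> transcribes.\<close>

lemma beta_iff: "beta a b i = r \<longleftrightarrow> r \<le> Suc i * b \<and> (\<exists>q\<le>a. q * Suc (Suc i * b) + r = a)"
proof -
  define d where "d = Suc (Suc i * b)"
  have "a mod d = r \<longleftrightarrow> r < d \<and> (\<exists>q\<le>a. q * d + r = a)"
  proof
    assume "r < d \<and> (\<exists>q\<le>a. q * d + r = a)"
    then show "a mod d = r" by auto
  next
    assume *: "a mod d = r"
    then have "a div d * d + r = a" by auto
    moreover have "a div d \<le> a" by simp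
    moreover have "r < d" unfolding *[symmetric] by (simp add: d_def)
    ultimately show "r < d \<and> (\<exists>q\<le>a. q * d + r = a)" by blast
  qed
  then show ?thesis by (simp add: beta_def d_def less_Suc_eq_le del: mult_Suc)
qed


section \<open>The graph of the diagonal function\<close>

definition Beta :: "tm \<Rightarrow> tm \<Rightarrow> tm \<Rightarrow> tm \<Rightarrow> fm" where
  "Beta a b i r = Conj (Le r (Times (Succ i) b))
    (BEx a (Eq (Plus (Times (Var 0) (Succ (Times (Succ (lift_tm i)) (lift_tm b)))) (lift_tm r)) (lift_tm a)))"

lemma fv_Beta [simp]: "fv (Beta a b i r) = fv_tm a \<union> fv_tm b \<union> fv_tm i \<union> fv_tm r"
  by (auto simp: Beta_def)

lemma sat_Beta [simp]: "sat e (Beta a b i r) \<longleftrightarrow> beta (val e a) (val e b) (val e i) = val e r"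
  by (simp add: Beta_def beta_iff)

text \<open>Cantor pairing is \<open>triangle (s + t) + s\<close>; the equation is doubled to clear
  the division by two in the triangular number.\<close>

definition IsPair :: "tm \<Rightarrow> tm \<Rightarrow> tm \<Rightarrow> fm" where
  "IsPair s t u = Eq (Plus (Times (Plus s t) (Succ (Plus s t))) (Plus s s)) (Plus u u)"

lemma fv_IsPair [simp]: "fv (IsPair s t u) = fv_tm s \<union> fv_tm t \<union> fv_tm u"
  by (auto simp: IsPair_def)

lemma sat_IsPair [simp]: "sat e (IsPair s t u) \<longleftrightarrow> val e u = prod_encode (val e s, val e t)"
proof -
  have "2 * triangle n = n * Suc n" for n by (induction n) auto
  from this[of "val e s + val e t"] show ?thesis
    by (auto simp: IsPair_def prod_encode_def)
qed

text \<open>One step of the recursion for codes of numerals; 2 is the tag of \<open>Succ\<close> in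
  \<open>gn_tm\<close>. Entries are remainders of \<open>a\<close>, hence at most \<open>a\<close>,
  so bounded quantifiers suffice.\<close>

definition Beta_step :: "tm \<Rightarrow> tm \<Rightarrow> tm \<Rightarrow> fm" where
  "Beta_step a b i = (let l = \<lambda>t. lift_tm (lift_tm t) in
    BEx a (BEx (lift_tm a) (Conj (Beta (l a) (l b) (l i) (Var 1))
      (Conj (Beta (l a) (l b) (Succ (l i)) (Var 0)) (IsPair (numeral_tm 2) (Var 1) (Var 0))))))"

lemma fv_Beta_step [simp]: "fv (Beta_step a b i) = fv_tm a \<union> fv_tm b \<union> fv_tm i"
  by (auto simp: Beta_step_def Let_def)

lemma sat_Beta_step [simp]:
  "sat e (Beta_step a b i) \<longleftrightarrow> beta (val e a) (val e b) (Suc (val e i)) =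
    prod_encode (2, beta (val e a) (val e b) (val e i))"
proof -
  have "(\<exists>u\<le>val e a. \<exists>v\<le>val e a. beta (val e a) b i = u \<and> beta (val e a) b j = v \<and>
      v = prod_encode (2, u)) \<longleftrightarrow>
    beta (val e a) b j = prod_encode (2, beta (val e a) b i)" for b i j
    using beta_le by blast
  then show ?thesis
    unfolding Beta_step_def Let_def by (simp del: ex_simps)
qed

text \<open>The code of a numeral arises by primitive recursion, so a beta sequence lists its
  history. As \<open>BAll\<close> includes its bound, the first disjunct exempts \<open>x\<close>,
  whose successor entry is left free.\<close>

definition Numeral_code :: "tm \<Rightarrow> tm \<Rightarrow> tm \<Rightarrow> fm" where
  "Numeral_code a b x = Conj (Beta a b Zero (numeral_tm (gn_tm Zero)))
    (BAll x (Disj (Eq (Var 0) (lift_tm x)) (Beta_step (lift_tm a) (lift_tm b) (Var 0))))"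

lemma fv_Numeral_code [simp]: "fv (Numeral_code a b x) = fv_tm a \<union> fv_tm b \<union> fv_tm x"
  by (auto simp: Numeral_code_def)

lemma sat_Numeral_code [simp]:
  "sat e (Numeral_code a b x) \<longleftrightarrow>
    (\<forall>i\<le>val e x. beta (val e a) (val e b) i = gn_tm (numeral_tm i))"
  (is "_ \<longleftrightarrow> (\<forall>i\<le>?x. ?b i = _)")
proof -
  have "sat e (Numeral_code a b x) \<longleftrightarrow> ?b 0 = gn_tm Zero \<and>
      (\<forall>i\<le>?x. i = ?x \<or> ?b (Suc i) = prod_encode (2, ?b i))"
    by (simp add: Numeral_code_def)
  also have "\<dots> \<longleftrightarrow> (\<forall>i\<le>?x. ?b i = gn_tm (numeral_tm i))"
  proof
    assume *: "?b 0 = gn_tm Zero \<and> (\<forall>i\<le>?x. i = ?x \<or> ?b (Suc i) = prod_encode (2, ?b i))"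
    have "i \<le> ?x \<Longrightarrow> ?b i = gn_tm (numeral_tm i)" for i
    proof (induction i)
      case (Suc i)
      then have "i \<le> ?x" "i \<noteq> ?x" by auto
      with * Suc show ?case by auto
    qed (use * in simp)
    then show "\<forall>i\<le>?x. ?b i = gn_tm (numeral_tm i)" by blast
  next
    assume *: "\<forall>i\<le>?x. ?b i = gn_tm (numeral_tm i)"
    then have "?b 0 = gn_tm Zero" by simp
    moreover have "i = ?x \<or> ?b (Suc i) = prod_encode (2, ?b i)" if "i \<le> ?x" for i
    proof (cases "i = ?x")
      case False
      with that have "Suc i \<le> ?x" by simp
      with * that show ?thesis by simp
    qed simp
    ultimately show "?b 0 = gn_tm Zero \<and> (\<forall>i\<le>?x. i = ?x \<or> ?b (Suc i) = prod_encode (2, ?b i))"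
      by blast
  qed
  finally show ?thesis .
qed

text \<open>The code of \<open>Forall (Imp (Eq (Var 0) t) \<chi>)\<close> from the codes \<open>h\<close> of \<open>t\<close> and \<open>x\<close> of \<open>\<chi>\<close>: Tarski's
  substitute for inserting \<open>t\<close> into \<open>\<chi>\<close>, which avoids arithmetizing substitution.\<close>

abbreviation diag_code :: "nat \<Rightarrow> nat \<Rightarrow> nat" where
  "diag_code h x \<equiv> prod_encode (3, prod_encode (2, prod_encode (prod_encode (0,
     prod_encode (0, h)), x)))"

text \<open>The 0 paired with \<open>h\<close> is the code of \<open>Var 0\<close>, since
  \<open>prod_encode (0, 0) = 0\<close>; the other constants are the tags of \<open>Eq\<close>,
  \<open>Imp\<close> and \<open>Forall\<close>.\<close>

lemma gn_Forall_Imp_Eq: "gn (Forall (Imp (Eq (Var 0) t) \<chi>)) = diag_code (gn_tm t) (gn \<chi>)"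
  by (simp add: prod_encode_def)

text \<open>The indices 3, 2, 1, 0 hold the nested pairs from the inside out. A pair is never below
  its components, so \<open>y\<close> bounds them all.\<close>

definition Diag_code :: "tm \<Rightarrow> tm \<Rightarrow> tm \<Rightarrow> fm" where
  "Diag_code h x y = (let l = (\<lambda>t. lift_tm (lift_tm (lift_tm (lift_tm t)))) in
    BEx y (BEx (lift_tm y) (BEx (lift_tm (lift_tm y)) (BEx (lift_tm (lift_tm (lift_tm y)))
      (Conj (IsPair Zero (l h) (Var 3)) (Conj (IsPair Zero (Var 3) (Var 2))
        (Conj (IsPair (Var 2) (l x) (Var 1)) (Conj (IsPair (numeral_tm 2) (Var 1) (Var 0))
          (IsPair (numeral_tm 3) (Var 0) (l y))))))))))"

lemma fv_Diag_code [simp]: "fv (Diag_code h x y) = fv_tm h \<union> fv_tm x \<union> fv_tm y"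
  by (auto simp: Diag_code_def Let_def)

lemma sat_Diag_code [simp]:
  "sat e (Diag_code h x y) \<longleftrightarrow> val e y = diag_code (val e h) (val e x)"
proof -
  let ?p = "prod_encode (0, val e h)"
  let ?q = "prod_encode (0, ?p)"
  let ?r = "prod_encode (?q, val e x)"
  let ?s = "prod_encode (2, ?r)"
  have "sat e (Diag_code h x y) \<longleftrightarrow> ?p \<le> val e y \<and> ?q \<le> val e y \<and> ?r \<le> val e y \<and>
      ?s \<le> val e y \<and> val e y = prod_encode (3, ?s)"
    unfolding Diag_code_def Let_def by auto
  moreover have "?p \<le> ?q" "?q \<le> ?r" "?r \<le> ?s" "?s \<le> prod_encode (3, ?s)"
    by (rule le_prod_encode_1 le_prod_encode_2)+
  ultimately show ?thesis by linarith
qed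

text \<open>Inside the three quantifiers the indices 0 to 5 are the code of the numeral, the beta
  parameters \<open>b\<close> and \<open>a\<close>, then witness, value and argument. The code is a
  beta value, so \<open>a\<close> bounds it.\<close>

definition Diag :: fm where
  "Diag = BEx (Var 0) (BEx (Var 1) (BEx (Var 1)
    (Conj (Numeral_code (Var 2) (Var 1) (Var 5)) (Conj (Beta (Var 2) (Var 1) (Var 5) (Var 0))
      (Diag_code (Var 0) (Var 5) (Var 4))))))"

lemma fv_Diag: "fv Diag \<subseteq> {0, 1, 2}"
  by (auto simp: Diag_def)

lemma sat_Diag:
  "sat e Diag \<longleftrightarrow> e 1 = diag_code (gn_tm (numeral_tm (e 2))) (e 2) \<and>
    (\<exists>a\<le>e 0. \<exists>b\<le>e 0. \<forall>i\<le>e 2. beta a b i = gn_tm (numeral_tm i))"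
proof -
  let ?h = "gn_tm (numeral_tm (e 2))"
  have "sat e Diag \<longleftrightarrow> e 1 = diag_code ?h (e 2) \<and>
    (\<exists>a\<le>e 0. ?h \<le> a \<and> (\<exists>b\<le>e 0. \<forall>i\<le>e 2. beta a b i = gn_tm (numeral_tm i)))"
    by (auto simp: Diag_def)
  moreover have "?h \<le> a" if "\<forall>i\<le>e 2. beta a b i = gn_tm (numeral_tm i)" for a b
    using that beta_le[of a b "e 2"] by simp
  ultimately show ?thesis by blast
qed

context Q_theory
begin

lemma representation_Diag: "representation T Diag (\<lambda>x. diag_code (gn_tm (numeral_tm x)) x)"
proof
  show "decides Diag"
    by (simp add: Diag_def Numeral_code_def Beta_step_def Let_def Diag_code_def Beta_def IsPair_def)
  show "fv Diag \<subseteq> {0, 1, 2}" by (rule fv_Diag)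
  show "e 1 = diag_code (gn_tm (numeral_tm (e 2))) (e 2)" if "sat e Diag" for e
    using that by (simp add: sat_Diag)
  show "\<exists>w\<ge>diag_code (gn_tm (numeral_tm x)) x. sat (env3 w (diag_code (gn_tm (numeral_tm x)) x) x) Diag" for x
  proof -
    let ?y = "diag_code (gn_tm (numeral_tm x)) x"
    obtain a b where ab: "\<forall>i\<le>x. beta a b i = gn_tm (numeral_tm i)"
      using beta_surjective[of x "\<lambda>i. gn_tm (numeral_tm i)"] by blast
    \<comment> \<open>Any number above both parameters is a witness, so it may be taken above the
      value too.\<close>
    let ?w = "max ?y (max a b)"
    have "a \<le> ?w" "b \<le> ?w" by linarith+
    with ab have "sat (env3 ?w ?y x) Diag"
      unfolding sat_Diag by (auto simp: numeral_2_eq_2 simp del: le_max_iff_disj)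
    then show ?thesis by (meson max.cobounded1)
  qed
qed

text \<open>\<open>\<chi>(x)\<close> says \<open>\<psi>\<close> of the diagonal value at
  \<open>x\<close>, and \<open>?G\<close> applies \<open>\<chi>\<close> to its own code. The
  diagonal value at that code is the code of \<open>?G\<close>.\<close>

theorem diagonal_lemma:
  assumes \<psi>: "fv \<psi> \<subseteq> {0}"
  obtains G where "sentence G" "T \<turnstile> Iff G (inst \<psi> (quote_fm G))"
proof -
  interpret representation T Diag "\<lambda>x. diag_code (gn_tm (numeral_tm x)) x" by (rule representation_Diag)
  define \<chi> where "\<chi> = Forall (Imp (Exists (least_witness Diag)) \<psi>)"
  have \<chi>: "fv \<chi> \<subseteq> {0}"
    unfolding \<chi>_def using fv_least_witness[OF fv_Diag] \<psi> by fastforce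
  let ?G = "Forall (Imp (Eq (Var 0) (numeral_tm (gn \<chi>))) \<chi>)"
  have "T \<turnstile> Iff ?G (inst \<psi> (numeral_tm (diag_code (gn_tm (numeral_tm (gn \<chi>))) (gn \<chi>))))"
    using Iff_trans[OF Forall_eq_iff_inst[OF \<chi>]] represents[OF \<psi>] unfolding \<chi>_def by blast
  then have "T \<turnstile> Iff ?G (inst \<psi> (quote_fm ?G))"
    unfolding quote_fm_def gn_Forall_Imp_Eq .
  moreover have "sentence ?G" using \<chi> by (auto simp: sentence_def)
  ultimately show thesis using that by blast
qed

end


section \<open>Soundness and Goedelian sentences\<close>

lemma goedelian_conj:
  assumes D: "derivability_conditions T Pr"
    and G: "goedelian T Pr G" and \<sigma>: "sentence \<sigma>" "T \<turnstile> \<sigma>"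
  shows "goedelian T Pr (Conj G \<sigma>)"
proof -
  let ?C = "Conj G \<sigma>" and ?Pr = "\<lambda>\<phi>. inst Pr (quote_fm \<phi>)"
  have sent: "sentence G" "sentence ?C" using G \<sigma> by (auto simp: goedelian_def sentence_def)
  have mono: "T \<turnstile> Imp (?Pr \<phi>) (?Pr \<psi>)"
    if "sentence \<phi>" "sentence \<psi>" "T \<turnstile> Imp \<phi> \<psi>" for \<phi> \<psi>
  proof -
    have "sentence (Imp \<phi> \<psi>)" using that by (simp add: sentence_def)
    then have "T \<turnstile> ?Pr (Imp \<phi> \<psi>)" and "T \<turnstile> Imp (?Pr (Imp \<phi> \<psi>)) (Imp (?Pr \<phi>) (?Pr \<psi>))"
      using D that unfolding derivability_conditions_def by blast+
    then show ?thesis by (rule ImpE[rotated])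
  qed
  have contra: "T \<turnstile> Imp (Neg \<beta>) (Neg \<alpha>)" if "T \<turnstile> Imp \<alpha> \<beta>" for \<alpha> \<beta>
  proof (intro ImpI)
    have "insert \<alpha> (insert (Neg \<beta>) T) \<turnstile> \<beta>"
      using that unfolding Imp_iff by (rule weaken) auto
    then show "insert \<alpha> (insert (Neg \<beta>) T) \<turnstile> Falsum" by (rule ImpE[rotated]) (simp add: Assm)
  qed
  have CG: "T \<turnstile> Imp ?C G"
  proof (rule ImpI)
    have "insert ?C T \<turnstile> ?C" by (simp add: Assm)
    then show "insert ?C T \<turnstile> G" unfolding Conj_iff ..
  qed
  have GC: "T \<turnstile> Imp G ?C"
  proof (rule ImpI)
    show "insert G T \<turnstile> ?C" unfolding Conj_iff using \<sigma> by (simp add: Assm weaken_insert)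
  qed
  have "T \<turnstile> Imp G (Neg (?Pr G))" "T \<turnstile> Imp (Neg (?Pr G)) G"
    using G unfolding goedelian_def Conj_iff by blast+
  \<comment> \<open>Both chains pass through \<open>G\<close> and the unprovability of
    \<open>G\<close>; contraposed monotonicity along \<open>CG\<close> leads from there to the
    unprovability of \<open>?C\<close>, along \<open>GC\<close> back.\<close>
  with CG GC have "T \<turnstile> Imp ?C (Neg (?Pr ?C))" "T \<turnstile> Imp (Neg (?Pr ?C)) ?C"
    using mono[OF sent(1,2) GC] mono[OF sent(2,1) CG] contra Imp_trans by blast+
  then show ?thesis using sent unfolding goedelian_def Conj_iff by blast
qed

theorem theorem1:
  fixes T :: "fm set" and Pr :: fm
  assumes "arith_theory T"
    and "re_theory T"
    and "extends_Q T"
    and "provability_predicate T Pr"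
    and "derivability_conditions T Pr"
  shows "sound T \<longleftrightarrow> (\<forall>G. goedelian T Pr G \<longrightarrow> true_in_N G)"
proof
  have fv_Pr: "fv Pr \<subseteq> {0}" using assms(4) by (simp add: provability_predicate_def)
  have sent_Pr: "sentence (inst Pr (quote_fm \<phi>))" for \<phi>
    unfolding quote_fm_def by (rule sentence_inst_numeral[OF fv_Pr])
  {
    assume sound: "sound T"
    show "\<forall>G. goedelian T Pr G \<longrightarrow> true_in_N G"
    proof (intro allI impI)
      fix G
      let ?P = "inst Pr (quote_fm G)"
      assume "goedelian T Pr G"
      then have G: "sentence G" and "T \<turnstile> Iff G (Neg ?P)" by (simp_all add: goedelian_def)
      moreover from G sent_Pr[of G] have "sentence (Iff G (Neg ?P))" by (simp add: sentence_def)
      ultimately have "true_in_N (Iff G (Neg ?P))" using sound unfolding sound_def by blast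
      then have "sat e G \<longleftrightarrow> \<not> sat e ?P" for e by (auto simp: true_in_N_def)
      \<comment> \<open>\<open>true_in_N\<close> quantifies over environments and need not commute
        with negation; for sentences the environment is irrelevant.\<close>
      then have "true_in_N G \<longleftrightarrow> \<not> true_in_N ?P"
        using sat_sentence[OF G] sat_sentence[OF sent_Pr] by blast
      moreover have "true_in_N ?P \<longleftrightarrow> T \<turnstile> G"
        using assms(4) G by (simp add: provability_predicate_def)
      moreover have "T \<turnstile> G \<Longrightarrow> true_in_N G" using sound G by (simp add: sound_def)
      ultimately show "true_in_N G" by blast
    qed
  next
    assume true: "\<forall>G. goedelian T Pr G \<longrightarrow> true_in_N G"
    interpret Q_theory T using assms(1,3) by unfold_locales
    have "fv (Neg Pr) \<subseteq> {0}" using fv_Pr by simp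
    then obtain G where "sentence G" "T \<turnstile> Iff G (inst (Neg Pr) (quote_fm G))"
      by (rule diagonal_lemma)
    then have G: "goedelian T Pr G" by (simp add: goedelian_def inst_def)
    show "sound T"
      unfolding sound_def
    proof (intro allI impI)
      fix \<sigma> assume "sentence \<sigma>" "T \<turnstile> \<sigma>"
      with true have "true_in_N (Conj G \<sigma>)"
        using goedelian_conj[OF assms(5) G] by blast
      then show "true_in_N \<sigma>" by (simp add: true_in_N_def)
    qed
  }
qed

end
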